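(* Let $(Y_i)_{i\ge 1}$ be independent real random variables with $E(Y_i)=\theta_i\in\Theta$ and $\mathrm{Var}(Y_i)=V(\theta_i)/\tau_i$, where $V(\theta)=\nu_0+\nu_1\theta+\nu_2\theta^2$. Assume: (A) $\limsup_{p\to\infty}\frac1p\sum_{i=1}^p \mathrm{Var}(Y_i)<\infty$; (B) $\limsup_{p\to\infty}\frac1p\sum_{i=1}^p \mathrm{Var}(Y_i)\,\theta_i^2<\infty$; (C) $\limsup_{p\to\infty}\frac1p\sum_{i=1}^p \mathrm{Var}(Y_i^2)<\infty$; (D) $\sup_i\left(\frac{\tau_i}{\tau_i+\nu_2}\right)^2<\infty$ and $\sup_i\left(\frac{\nu_1}{\tau_i+\nu_2}\right)^2<\infty$; (E) $\limsup_{p\to\infty}\frac{1}{p^{1-\varepsilon}}E\left(\max_{1\le i\le p}Y_i^2\right)<\infty$ for some $\varepsilon>0$. For each $p$ let $\hat{\boldsymbol\theta}^{\mathrm{SG}}$ be the semiparametric URE grand-mean shrinkage estimator, and let $\hat{\boldsymbol\theta}^{\hat{\mathbf b},\bar Y}$, $\hat\theta_i^{\hat{\mathbf b},\bar Y}=(1-\hat b_i)Y_i+\hat b_i\bar Y$, be any shrinkage estimator where the (random) $\hat{\mathbf b}\in[0,1]^p$ satisfies Requirement (MON). Then for any $\varepsilon>0$ $$\lim_{p\to\infty}P\left(l_p(\boldsymbol\theta,\hat{\boldsymbol\theta}^{\mathrm{SG}})\ge l_p(\boldsymbol\theta,\hat{\boldsymbol\theta}^{\hat{\mathbf b},\bar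 Y})+\varepsilon\right)=0$$ and $$\limsup_{p\to\infty}\left[R_p(\boldsymbol\theta,\hat{\boldsymbol\theta}^{\mathrm{SG}})-R_p(\boldsymbol\theta,\hat{\boldsymbol\theta}^{\hat{\mathbf b},\bar Y})\right]\le0.$$
   Context: $\nu_0,\nu_1,\nu_2$ are known real constants, $\Theta\subseteq\{\theta\in\mathbb R:V(\theta)\ge0\}$, $(\theta_i)_{i\ge1}$ is a fixed (deterministic) sequence in $\Theta$, and $(\tau_i)_{i\ge1}$ is a fixed known sequence of positive reals with $\tau_i+\nu_2\ne0$. For each $p$ only $Y_1,\dots,Y_p$ are used, and $\bar Y=\frac1p\sum_{i=1}^pY_i$. Requirement (MON) for $\mathbf b=(b_1,\dots,b_p)$: $b_i\le b_j$ for all $i,j\in\{1,\dots,p\}$ with $\tau_i\ge\tau_j$. Loss and risk: $l_p(\boldsymbol\theta,\hat{\boldsymbol\theta})=\frac1p\sum_{i=1}^p(\hat\theta_i-\theta_i)^2$, $R_p(\boldsymbol\theta,\hat{\boldsymbol\theta})=E[l_p(\boldsymbol\theta,\hat{\boldsymbol\theta})]$. $\mathrm{URE}^G(\mathbf b)=\frac1p\sum_{i=1}^p\left[b_i^2(Y_i-\bar Y)^2+\left(1-2\left(1-\tfrac1p\right)b_i\right)\frac{V(Y_i)}{\tau_i+\nu_2}\right]$. Semiparametric URE grand-mean shrinkage estimator: $\hat\theta_i^{\mathrm{SG}}=(1-\hat b_i^{\mathrm{SG}})Y_i+\hat b_i^{\mathrm{SG}}\bar Y$, where $\hat{\mathbf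 b}^{\mathrm{SG}}$ is a (measurable) minimizer of $\mathrm{URE}^G(\mathbf b)$ subject to $\mathbf b\in[0,1]^p$ and Requirement (MON). All random quantities are measurable. *)

theory Defs
  imports "HOL-Probability.Probability"
begin

text \<open>
  Vectors of length p are functions of type \<open>nat \<Rightarrow> real\<close> of which only the
  values at the indices \<open>1, \<dots>, p\<close> matter.
\<close>

definition quad_var :: "real \<Rightarrow> real \<Rightarrow> real \<Rightarrow> real \<Rightarrow> real" where
  "quad_var \<nu>0 \<nu>1 \<nu>2 t = \<nu>0 + \<nu>1 * t + \<nu>2 * t\<^sup>2"

definition grand_mean :: "nat \<Rightarrow> (nat \<Rightarrow> real) \<Rightarrow> real" where
  "grand_mean p y = 1 / real p * (\<Sum>i=1..p. y i)"

definition MON :: "nat \<Rightarrow> (nat \<Rightarrow> real) \<Rightarrow> (nat \<Rightarrow> real) \<Rightarrow> bool" where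
  "MON p \<tau> b \<longleftrightarrow> (\<forall>i\<in>{1..p}. \<forall>j\<in>{1..p}. \<tau> i \<ge> \<tau> j \<longrightarrow> b i \<le> b j)"

definition admissible_weights :: "nat \<Rightarrow> (nat \<Rightarrow> real) \<Rightarrow> (nat \<Rightarrow> real) \<Rightarrow> bool" where
  "admissible_weights p \<tau> b \<longleftrightarrow> (\<forall>i\<in>{1..p}. b i \<in> {0..1}) \<and> MON p \<tau> b"

definition loss :: "nat \<Rightarrow> (nat \<Rightarrow> real) \<Rightarrow> (nat \<Rightarrow> real) \<Rightarrow> real" where
  "loss p \<theta> t = 1 / real p * (\<Sum>i=1..p. (t i - \<theta> i)\<^sup>2)"

definition risk :: "'a measure \<Rightarrow> nat \<Rightarrow> (nat \<Rightarrow> real) \<Rightarrow> ('a \<Rightarrow> nat \<Rightarrow> real) \<Rightarrow> real" where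
  "risk M p \<theta> t = (\<integral>\<omega>. loss p \<theta> (t \<omega>) \<partial>M)"

definition shrink :: "nat \<Rightarrow> (nat \<Rightarrow> real) \<Rightarrow> (nat \<Rightarrow> real) \<Rightarrow> nat \<Rightarrow> real" where
  "shrink p b y i = (1 - b i) * y i + b i * grand_mean p y"

definition URE_G :: "real \<Rightarrow> real \<Rightarrow> real \<Rightarrow> (nat \<Rightarrow> real) \<Rightarrow> nat \<Rightarrow> (nat \<Rightarrow> real) \<Rightarrow> (nat \<Rightarrow> real) \<Rightarrow> real" where
  "URE_G \<nu>0 \<nu>1 \<nu>2 \<tau> p y b = 1 / real p *
     (\<Sum>i=1..p. (b i)\<^sup>2 * (y i - grand_mean p y)\<^sup>2
        + (1 - 2 * (1 - 1 / real p) * b i) * (quad_var \<nu>0 \<nu>1 \<nu>2 (y i) / (\<tau> i + \<nu>2)))"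

definition random_weights :: "'a measure \<Rightarrow> nat \<Rightarrow> (nat \<Rightarrow> real) \<Rightarrow> ('a \<Rightarrow> nat \<Rightarrow> real) \<Rightarrow> bool" where
  "random_weights M p \<tau> B \<longleftrightarrow>
     (\<forall>i\<in>{1..p}. (\<lambda>\<omega>. B \<omega> i) \<in> borel_measurable M) \<and>
     (\<forall>\<omega>\<in>space M. admissible_weights p \<tau> (B \<omega>))"

text \<open>
  The minimizer of \<open>URE_G\<close> need not be unique, so being a vector of semiparametric
  URE weights is a predicate.
\<close>

definition SG_weights ::
  "'a measure \<Rightarrow> real \<Rightarrow> real \<Rightarrow> real \<Rightarrow> (nat \<Rightarrow> real) \<Rightarrow> nat \<Rightarrow> (nat \<Rightarrow> 'a \<Rightarrow> real) \<Rightarrow> ('a \<Rightarrow> nat \<Rightarrow> real) \<Rightarrow> bool" where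
  "SG_weights M \<nu>0 \<nu>1 \<nu>2 \<tau> p Y B \<longleftrightarrow>
     (\<forall>i\<in>{1..p}. (\<lambda>\<omega>. B \<omega> i) \<in> borel_measurable M) \<and>
     (\<forall>\<omega>\<in>space M. is_arg_min (URE_G \<nu>0 \<nu>1 \<nu>2 \<tau> p (\<lambda>i. Y i \<omega>)) (admissible_weights p \<tau>) (B \<omega>))"

end

theory Submission
  imports Defs
begin

text \<open>
  Write $W_i = V(Y_i)/(\tau_i+\nu_2)$. Since $V$ is quadratic, $W_i$ is an unbiased estimate of
  $\mathrm{Var}(Y_i)$. Expanding both functions shows that, up to a term that does not
  depend on the weights, the loss of the estimator with weights $b$ differs from
  $\mathrm{URE}^G(b)$ only by
  \[ D(b) = \frac2p \Big( \sum_i b_i X_i + \bar Y \sum_i b_i (Y_i-\theta_i)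
       - \frac1p \sum_i b_i W_i \Big), \qquad X_i = W_i - Y_i (Y_i - \theta_i), \]
  where the $X_i$ are independent with mean zero. As the weights $\hat b^{SG}$ minimize
  $\mathrm{URE}^G$ pointwise, the excess of their loss over that of any other admissible weights is
  at most $2 \sup_b |D(b)|$. Both claims therefore follow from $E \sup_b |D(b)| \to 0$:
  the first by Markov's inequality, the second by integrating.

  The supremum over the infinite family of admissible $b$ is reduced to a finite one by
  monotonicity. Along an enumeration of the indices with increasing $\tau$ the weights decrease
  within $[0,1]$, and summation by parts bounds $|\sum_i b_i x_i|$ by the largest absolute partial
  sum of $x$ along that enumeration (\<open>admissible_weighted_sum_le\<close>). For independent centred
  variables the square of that maximum has expectation at most four times the sum of the variances
  (\<open>L2_maximal_inequality\<close>).

  By (A)--(D), both $\sum_i \mathrm{Var}(X_i)$ and $\sum_i \mathrm{Var}(Y_i)$ are $O(p)$, so the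
  first maximum is $O(\sqrt p)$ in mean. In the second term the maximum is multiplied by
  $|\bar Y|$; as $\bar Y^2 \le \max_i Y_i^2$, condition (E) makes $E \bar Y^2$ of order
  $p^{1-\varepsilon}$ and the product $O(p^{1-\varepsilon/2})$ in mean. The last term is $O(1)$.
  Division by $p$ sends all three to zero.
\<close>

section \<open>Largest absolute partial sums\<close>

text \<open>
  The empty sum is included, and the last argument counts the summands. Recursion lets
  measurability, integrability and the pathwise estimate below be proved by induction.
\<close>
primrec max_partial_sum :: "(nat \<Rightarrow> real) \<Rightarrow> nat \<Rightarrow> real" where
  "max_partial_sum x 0 = 0"
| "max_partial_sum x (Suc n) = max (max_partial_sum x n) \<bar>\<Sum>k<Suc n. x k\<bar>"

lemma max_partial_sum_nonneg: "0 \<le> max_partial_sum x n"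
  by (induction n) (auto simp: max_def)

lemma abs_sum_le_max_partial_sum: "k \<le> n \<Longrightarrow> \<bar>\<Sum>j<k. x j\<bar> \<le> max_partial_sum x n"
proof (induction n)
  case (Suc n)
  then show ?case
    by (cases "k = Suc n") (auto simp: max_def simp del: sum.lessThan_Suc)
qed simp

lemma max_partial_sum_cong:
  "(\<And>k. k < n \<Longrightarrow> x k = y k) \<Longrightarrow> max_partial_sum x n = max_partial_sum y n"
  by (induction n) auto

lemma max_partial_sum_measurable:
  assumes "\<And>k. k < n \<Longrightarrow> X k \<in> borel_measurable M"
  shows "(\<lambda>\<omega>. max_partial_sum (\<lambda>k. X k \<omega>) n) \<in> borel_measurable M"
  using assms
proof (induction n)
  case (Suc n)
  have "(\<lambda>\<omega>. \<Sum>k<Suc n. X k \<omega>) \<in> borel_measurable M"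
    by (intro borel_measurable_sum Suc.prems) auto
  with Suc show ?case
    by (auto intro!: borel_measurable_max simp del: sum.lessThan_Suc)
qed simp

text \<open>
  A decreasing sequence in $[0,1]$ is a mixture of indicators of initial segments and of the zero
  sequence, so a linear functional takes its largest value at an initial segment.
\<close>
lemma decreasing_weighted_sum_le:
  fixes b x :: "nat \<Rightarrow> real"
  assumes dec: "\<And>j k. j \<le> k \<Longrightarrow> k < n \<Longrightarrow> b k \<le> b j"
    and unit: "\<And>k. k < n \<Longrightarrow> 0 \<le> b k \<and> b k \<le> 1"
    and bound: "\<And>k. k \<le> n \<Longrightarrow> (\<Sum>j<k. x j) \<le> c"
  shows "(\<Sum>k<n. b k * x k) \<le> c"
proof (cases n)
  case 0
  then show ?thesis using bound[of 0] by simp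
next
  case (Suc m)
  have c: "0 \<le> c" using bound[of 0] by simp
  \<comment> \<open>Summation by parts, with the increments of \<open>b\<close> below \<open>b 0\<close> already estimated.\<close>
  have "(\<Sum>k<Suc l. b k * x k) \<le> b l * (\<Sum>k<Suc l. x k) + (b 0 - b l) * c" if "l \<le> m" for l
    using that
  proof (induction l)
    case 0
    then show ?case by simp
  next
    case (Suc l)
    have "(b l - b (Suc l)) * (\<Sum>k<Suc l. x k) \<le> (b l - b (Suc l)) * c"
      by (intro mult_left_mono bound) (use dec[of l "Suc l"] Suc.prems \<open>n = Suc m\<close> in auto)
    then show ?case using Suc by (simp add: algebra_simps)
  qed
  from this[of m] have "(\<Sum>k<n. b k * x k) \<le> b m * (\<Sum>k<n. x k) + (b 0 - b m) * c"
    using Suc by simp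
  also have "\<dots> \<le> b m * c + (b 0 - b m) * c"
    by (intro add_right_mono mult_left_mono bound) (use unit[of m] Suc in auto)
  also have "\<dots> = b 0 * c" by (simp add: algebra_simps)
  also have "\<dots> \<le> 1 * c" by (intro mult_right_mono) (use unit[of 0] Suc c in auto)
  finally show ?thesis by simp
qed

lemma abs_decreasing_weighted_sum_le:
  fixes b x :: "nat \<Rightarrow> real"
  assumes dec: "\<And>j k. j \<le> k \<Longrightarrow> k < n \<Longrightarrow> b k \<le> b j"
    and unit: "\<And>k. k < n \<Longrightarrow> 0 \<le> b k \<and> b k \<le> 1"
  shows "\<bar>\<Sum>k<n. b k * x k\<bar> \<le> max_partial_sum x n"
proof -
  have "(\<Sum>k<n. b k * x k) \<le> max_partial_sum x n"
    by (rule decreasing_weighted_sum_le[OF dec unit])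
       (use abs_sum_le_max_partial_sum abs_le_D1 in blast)+
  moreover have "(\<Sum>k<n. b k * - x k) \<le> max_partial_sum x n"
    by (rule decreasing_weighted_sum_le[OF dec unit])
       (use abs_sum_le_max_partial_sum[where x = x] abs_le_D2 in \<open>auto simp: sum_negf\<close>)
  ultimately show ?thesis by (simp add: sum_negf abs_le_iff)
qed

text \<open>
  A pathwise form of Doob's $L^2$ inequality. The sum on the right is a discrete stochastic
  integral whose integrand at step $k$ uses only the first $k$ terms, so it disappears when
  expectations are taken over independent centred terms. The idea is to integrate the
  running maximum $m$ against the increments of $|S|$ by parts: $m$ moves only when $|S| = m$, so
  $\sum |S_{k+1}| (m_{k+1}-m_k) \ge m_n^2/2$. The sign enters because
  $|S_{k+1}| - |S_k| \ge \mathrm{sgn}(S_k)\, x_k$.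
\<close>
lemma max_partial_sum_sq_le:
  "(max_partial_sum x n)\<^sup>2 \<le> 4 * (\<Sum>k<n. x k)\<^sup>2
     - 4 * (\<Sum>k<n. max_partial_sum x k * sgn (\<Sum>j<k. x j) * x k)"
proof -
  let ?m = "max_partial_sum x" and ?S = "\<lambda>n. \<Sum>k<n. x k"
  have "(?m n)\<^sup>2 / 2 \<le> ?m n * \<bar>?S n\<bar> - (\<Sum>k<n. ?m k * sgn (?S k) * x k)"
  proof (induction n)
    case (Suc n)
    have sub: "\<bar>?S n\<bar> + sgn (?S n) * x n \<le> \<bar>?S (Suc n)\<bar>"
      by (auto simp: sgn_if)
    have "?m n * (\<bar>?S n\<bar> + sgn (?S n) * x n) \<le> ?m n * \<bar>?S (Suc n)\<bar>"
      by (intro mult_left_mono sub max_partial_sum_nonneg)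
    then have step: "(?m n)\<^sup>2 / 2 \<le> ?m n * \<bar>?S (Suc n)\<bar> - (\<Sum>k<Suc n. ?m k * sgn (?S k) * x k)"
      using Suc.IH by (simp add: algebra_simps)
    \<comment> \<open>The maximum only moves when it is attained by the new partial sum.\<close>
    show ?case
    proof (cases "\<bar>?S (Suc n)\<bar> \<le> ?m n")
      case True
      then have "?m (Suc n) = ?m n" by (simp del: sum.lessThan_Suc)
      with step show ?thesis by simp
    next
      case False
      then have eq: "?m (Suc n) = \<bar>?S (Suc n)\<bar>" by (simp del: sum.lessThan_Suc)
      have "s\<^sup>2 / 2 \<le> s * s + m\<^sup>2 / 2 - m * s" for s m :: real
        using sum_squares_bound[of s m] by (simp add: power2_eq_square algebra_simps)
      from this[of "\<bar>?S (Suc n)\<bar>" "?m n"] step show ?thesis unfolding eq by linarith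
    qed
  qed simp
  moreover have "?m n * \<bar>?S n\<bar> \<le> (?m n)\<^sup>2 / 4 + (?S n)\<^sup>2"
  proof -
    have "0 \<le> (?m n / 2 - \<bar>?S n\<bar>)\<^sup>2" by simp
    then show ?thesis by (simp add: power2_diff power_divide)
  qed
  ultimately show ?thesis by linarith
qed

section \<open>The maximal inequality for independent centred variables\<close>

lemma integrable_mult_of_squares:
  fixes f g :: "'a \<Rightarrow> real"
  assumes [measurable]: "f \<in> borel_measurable M" "g \<in> borel_measurable M"
    and "integrable M (\<lambda>x. (f x)\<^sup>2)" "integrable M (\<lambda>x. (g x)\<^sup>2)"
  shows "integrable M (\<lambda>x. f x * g x)"
proof (rule Bochner_Integration.integrable_bound)
  show "integrable M (\<lambda>x. (f x)\<^sup>2 + (g x)\<^sup>2)" using assms by simp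
  have "\<bar>a * b\<bar> \<le> a\<^sup>2 + b\<^sup>2" for a b :: real
    using sum_squares_bound[of "\<bar>a\<bar>" "\<bar>b\<bar>"] mult_nonneg_nonneg[OF abs_ge_zero[of a] abs_ge_zero[of b]]
    unfolding abs_mult power2_abs by linarith
  then show "AE x in M. norm (f x * g x) \<le> norm ((f x)\<^sup>2 + (g x)\<^sup>2)" by simp
qed simp

lemma integrable_max_partial_sum_sq:
  fixes X :: "nat \<Rightarrow> 'a \<Rightarrow> real"
  assumes X: "\<And>k. k < n \<Longrightarrow> X k \<in> borel_measurable M"
    and sq: "\<And>k. k < n \<Longrightarrow> integrable M (\<lambda>\<omega>. (X k \<omega>)\<^sup>2)"
  shows "integrable M (\<lambda>\<omega>. (\<Sum>k<n. X k \<omega>)\<^sup>2)"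
    and "integrable M (\<lambda>\<omega>. (max_partial_sum (\<lambda>k. X k \<omega>) n)\<^sup>2)"
proof -
  have sum: "integrable M (\<lambda>\<omega>. (\<Sum>k<m. X k \<omega>)\<^sup>2)" if "m \<le> n" for m
    unfolding power2_eq_square sum_product
    using that by (intro Bochner_Integration.integrable_sum integrable_mult_of_squares X sq) auto
  then show "integrable M (\<lambda>\<omega>. (\<Sum>k<n. X k \<omega>)\<^sup>2)" by simp
  have "integrable M (\<lambda>\<omega>. (max_partial_sum (\<lambda>k. X k \<omega>) m)\<^sup>2)" if "m \<le> n" for m
    using that
  proof (induction m)
    case (Suc m)
    have meas: "(\<lambda>\<omega>. max_partial_sum (\<lambda>k. X k \<omega>) (Suc m)) \<in> borel_measurable M"
      by (rule max_partial_sum_measurable) (use X Suc.prems in auto)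
    have max_sq: "(max a \<bar>b\<bar>)\<^sup>2 \<le> a\<^sup>2 + b\<^sup>2" for a b :: real by (simp add: max_def)
    have "integrable M (\<lambda>\<omega>. (max_partial_sum (\<lambda>k. X k \<omega>) m)\<^sup>2 + (\<Sum>k<Suc m. X k \<omega>)\<^sup>2)"
      by (rule Bochner_Integration.integrable_add) (use Suc sum[of "Suc m"] in simp_all)
    then show ?case
    proof (rule Bochner_Integration.integrable_bound)
      show "(\<lambda>\<omega>. (max_partial_sum (\<lambda>k. X k \<omega>) (Suc m))\<^sup>2) \<in> borel_measurable M"
        by (rule borel_measurable_power[OF meas])
      have "(max_partial_sum x (Suc m))\<^sup>2 \<le> (max_partial_sum x m)\<^sup>2 + (\<Sum>k<Suc m. x k)\<^sup>2" for x
        unfolding max_partial_sum.simps by (rule max_sq)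
      then show "AE \<omega> in M. norm ((max_partial_sum (\<lambda>k. X k \<omega>) (Suc m))\<^sup>2)
          \<le> norm ((max_partial_sum (\<lambda>k. X k \<omega>) m)\<^sup>2 + (\<Sum>k<Suc m. X k \<omega>)\<^sup>2)"
        by (intro AE_I2) (simp del: sum.lessThan_Suc max_partial_sum.simps)
    qed
  qed simp
  then show "integrable M (\<lambda>\<omega>. (max_partial_sum (\<lambda>k. X k \<omega>) n)\<^sup>2)" by simp
qed

context prob_space begin

text \<open>
  Functions of the past are orthogonal to the next centred variable; this replaces martingale
  theory in the maximal inequality.
\<close>
lemma expectation_past_times_next:
  fixes X :: "nat \<Rightarrow> 'a \<Rightarrow> real"
  assumes indep: "indep_vars (\<lambda>_. borel) X {..<n}" and k: "k < n"
    and f: "f \<in> borel_measurable (\<Pi>\<^sub>M i\<in>{..<k}. borel)"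
    and g: "integrable M g" "\<And>\<omega>. g \<omega> = f (\<lambda>i\<in>{..<k}. X i \<omega>)"
    and X: "integrable M (X k)" "expectation (X k) = 0"
  shows "expectation (\<lambda>\<omega>. g \<omega> * X k \<omega>) = 0"
proof -
  have "indep_var borel (f \<circ> (\<lambda>\<omega>. \<lambda>i\<in>{..<k}. X i \<omega>)) borel ((\<lambda>h. h k) \<circ> (\<lambda>\<omega>. \<lambda>i\<in>{k}. X i \<omega>))"
    by (intro indep_var_compose[OF indep_var_restrict[OF indep]] f) (use k in auto)
  also have "f \<circ> (\<lambda>\<omega>. \<lambda>i\<in>{..<k}. X i \<omega>) = g" using g by (auto simp: fun_eq_iff)
  also have "(\<lambda>h. h k) \<circ> (\<lambda>\<omega>. \<lambda>i\<in>{k}. X i \<omega>) = X k" by auto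
  finally show ?thesis using indep_var_lebesgue_integral[OF _ g(1) X(1)] X(2) by simp
qed

lemma L2_maximal_inequality:
  fixes X :: "nat \<Rightarrow> 'a \<Rightarrow> real"
  assumes indep: "indep_vars (\<lambda>_. borel) X {..<n}"
    and sq: "\<And>k. k < n \<Longrightarrow> integrable M (\<lambda>\<omega>. (X k \<omega>)\<^sup>2)"
    and mean: "\<And>k. k < n \<Longrightarrow> expectation (X k) = 0"
  shows "expectation (\<lambda>\<omega>. (max_partial_sum (\<lambda>k. X k \<omega>) n)\<^sup>2)
    \<le> 4 * (\<Sum>k<n. expectation (\<lambda>\<omega>. (X k \<omega>)\<^sup>2))"
proof -
  let ?S = "\<lambda>k \<omega>. \<Sum>j<k. X j \<omega>" and ?m = "\<lambda>k \<omega>. max_partial_sum (\<lambda>k. X k \<omega>) k"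
  have X: "X k \<in> borel_measurable M" if "k < n" for k
    using indep that by (auto simp: indep_vars_def)
  have intX: "integrable M (X k)" if "k < n" for k
    by (rule square_integrable_imp_integrable[OF X sq]) (use that in auto)
  have Sm: "?S k \<in> borel_measurable M" if "k \<le> n" for k
    using that by (intro borel_measurable_sum X) auto
  have mm: "?m k \<in> borel_measurable M" if "k \<le> n" for k
    using that by (intro max_partial_sum_measurable X) auto
  have S2: "integrable M (\<lambda>\<omega>. (?S k \<omega>)\<^sup>2)" and m2: "integrable M (\<lambda>\<omega>. (?m k \<omega>)\<^sup>2)" if "k \<le> n" for k
    using that by (intro integrable_max_partial_sum_sq X sq; simp)+
  have SX: "integrable M (\<lambda>\<omega>. ?S k \<omega> * X k \<omega>)" if "k < n" for k
    using that by (intro integrable_mult_of_squares X sq Sm S2) auto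
  have g2: "integrable M (\<lambda>\<omega>. (?m k \<omega> * sgn (?S k \<omega>))\<^sup>2)" if "k < n" for k
  proof (rule Bochner_Integration.integrable_bound[OF m2])
    show "k \<le> n" using that by simp
    show "(\<lambda>\<omega>. (?m k \<omega> * sgn (?S k \<omega>))\<^sup>2) \<in> borel_measurable M"
      using mm[of k] Sm[of k] that by (intro borel_measurable_power borel_measurable_times borel_measurable_sgn) auto
  qed (auto simp: power_mult_distrib sgn_if)
  have gm: "(\<lambda>\<omega>. ?m k \<omega> * sgn (?S k \<omega>)) \<in> borel_measurable M" if "k < n" for k
    using mm[of k] Sm[of k] that by (intro borel_measurable_times borel_measurable_sgn) auto
  have gX: "integrable M (\<lambda>\<omega>. ?m k \<omega> * sgn (?S k \<omega>) * X k \<omega>)" if "k < n" for k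
    using that by (intro integrable_mult_of_squares X sq gm g2)
  have orth_S: "expectation (\<lambda>\<omega>. ?S k \<omega> * X k \<omega>) = 0" if "k < n" for k
  proof (rule expectation_past_times_next[OF indep that, where f = "\<lambda>x. \<Sum>j<k. x j"])
    show "integrable M (?S k)"
      using that by (intro Bochner_Integration.integrable_sum intX) auto
  qed (use that intX mean in auto)
  have orth_m: "expectation (\<lambda>\<omega>. ?m k \<omega> * sgn (?S k \<omega>) * X k \<omega>) = 0" if "k < n" for k
  proof (rule expectation_past_times_next[OF indep that,
        where f = "\<lambda>x. max_partial_sum x k * sgn (\<Sum>j<k. x j)"])
    have "(\<lambda>x. max_partial_sum (\<lambda>j. x j) k) \<in> borel_measurable (\<Pi>\<^sub>M i\<in>{..<k}. borel)"
      by (rule max_partial_sum_measurable) auto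
    then show "(\<lambda>x. max_partial_sum x k * sgn (\<Sum>j<k. x j)) \<in> borel_measurable (\<Pi>\<^sub>M i\<in>{..<k}. borel)"
      by (intro borel_measurable_times borel_measurable_sgn) auto
    show "integrable M (\<lambda>\<omega>. ?m k \<omega> * sgn (?S k \<omega>))"
      by (rule square_integrable_imp_integrable[OF gm[OF that] g2[OF that]])
    show "?m k \<omega> * sgn (?S k \<omega>) = max_partial_sum (\<lambda>i\<in>{..<k}. X i \<omega>) k
        * sgn (\<Sum>j<k. (\<lambda>i\<in>{..<k}. X i \<omega>) j)" for \<omega>
      by (simp cong: max_partial_sum_cong)
  qed (use that intX mean in auto)
  have var: "expectation (\<lambda>\<omega>. (?S k \<omega>)\<^sup>2) = (\<Sum>j<k. expectation (\<lambda>\<omega>. (X j \<omega>)\<^sup>2))" if "k \<le> n" for k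
    using that
  proof (induction k)
    case (Suc k)
    have "expectation (\<lambda>\<omega>. (?S (Suc k) \<omega>)\<^sup>2)
      = expectation (\<lambda>\<omega>. (?S k \<omega>)\<^sup>2 + 2 * (?S k \<omega> * X k \<omega>) + (X k \<omega>)\<^sup>2)"
      by (intro Bochner_Integration.integral_cong) (auto simp: power2_sum)
    also have "\<dots> = expectation (\<lambda>\<omega>. (?S k \<omega>)\<^sup>2) + expectation (\<lambda>\<omega>. (X k \<omega>)\<^sup>2)"
      using Suc.prems S2[of k] SX[of k] sq[of k] orth_S[of k] by simp
    finally show ?case using Suc by simp
  qed simp
  have "expectation (\<lambda>\<omega>. (?m n \<omega>)\<^sup>2) \<le> expectation (\<lambda>\<omega>. 4 * (?S n \<omega>)\<^sup>2
      - 4 * (\<Sum>k<n. ?m k \<omega> * sgn (?S k \<omega>) * X k \<omega>))"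
    by (intro integral_mono max_partial_sum_sq_le m2 Bochner_Integration.integrable_diff
          integrable_mult_right S2 Bochner_Integration.integrable_sum gX) auto
  also have "\<dots> = 4 * expectation (\<lambda>\<omega>. (?S n \<omega>)\<^sup>2)
      - 4 * (\<Sum>k<n. expectation (\<lambda>\<omega>. ?m k \<omega> * sgn (?S k \<omega>) * X k \<omega>))"
    using S2[of n] gX
    by (subst Bochner_Integration.integral_diff) (auto simp: Bochner_Integration.integral_sum)
  also have "\<dots> = 4 * (\<Sum>k<n. expectation (\<lambda>\<omega>. (X k \<omega>)\<^sup>2))"
    using orth_m var[of n] by simp
  finally show ?thesis .
qed

text \<open>
  Independence of the given sequence has to be transferred to its enumeration by increasing
  $\tau$, which changes with $p$.
\<close>
lemma indep_vars_reindex: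
  assumes indep: "indep_vars (\<lambda>_. N) X I" and inj: "inj_on \<sigma> L" and sub: "\<sigma> ` L \<subseteq> I"
  shows "indep_vars (\<lambda>_. N) (\<lambda>j. X (\<sigma> j)) L"
proof -
  have "indep_vars (\<lambda>j. PiM {\<sigma> j} (\<lambda>_. N)) (\<lambda>j \<omega>. restrict (\<lambda>i. X i \<omega>) {\<sigma> j}) L"
    by (rule indep_vars_restrict[OF indep])
       (use sub inj in \<open>auto simp: disjoint_family_on_def inj_on_def\<close>)
  then have "indep_vars (\<lambda>_. N) (\<lambda>j. (\<lambda>h. h (\<sigma> j)) \<circ> (\<lambda>\<omega>. restrict (\<lambda>i. X i \<omega>) {\<sigma> j})) L"
    by (rule indep_vars_compose) auto
  then show ?thesis by (simp add: comp_def)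
qed

end

section \<open>Comparing the loss with the risk estimate\<close>

lemma increasing_enumeration:
  fixes \<tau> :: "nat \<Rightarrow> real"
  obtains \<sigma> where "bij_betw \<sigma> {..<p} {1..p}"
    and "\<And>j k. j \<le> k \<Longrightarrow> k < p \<Longrightarrow> \<tau> (\<sigma> j) \<le> \<tau> (\<sigma> k)"
proof
  let ?xs = "sort_key \<tau> [1..<Suc p]"
  show "bij_betw ((!) ?xs) {..<p} {1..p}"
    by (rule bij_betw_nth) (auto simp: atLeastLessThanSuc_atLeastAtMost)
  show "\<tau> (?xs ! j) \<le> \<tau> (?xs ! k)" if "j \<le> k" "k < p" for j k
    using sorted_nth_mono[OF sorted_sort_key[of \<tau> "[1..<Suc p]"], of j k] that by simp
qed

text \<open>
  Monotonicity of the weights enters here: a supremum over all admissible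
  weights, which may depend on the data, is bounded by a quantity free of the weights.
\<close>
lemma admissible_weighted_sum_le:
  assumes adm: "admissible_weights p \<tau> b"
    and bij: "bij_betw \<sigma> {..<p} {1..p}"
    and inc: "\<And>j k. j \<le> k \<Longrightarrow> k < p \<Longrightarrow> \<tau> (\<sigma> j) \<le> \<tau> (\<sigma> k)"
  shows "\<bar>\<Sum>i=1..p. b i * x i\<bar> \<le> max_partial_sum (\<lambda>k. x (\<sigma> k)) p"
proof -
  have mem: "\<sigma> k \<in> {1..p}" if "k < p" for k
    using bij that by (auto simp: bij_betw_def)
  have "(\<Sum>i=1..p. b i * x i) = (\<Sum>k<p. b (\<sigma> k) * x (\<sigma> k))"
    by (rule sum.reindex_bij_betw[OF bij, symmetric])
  moreover have "\<bar>\<Sum>k<p. b (\<sigma> k) * x (\<sigma> k)\<bar> \<le> max_partial_sum (\<lambda>k. x (\<sigma> k)) p"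
  proof (rule abs_decreasing_weighted_sum_le)
    show "b (\<sigma> k) \<le> b (\<sigma> j)" if "j \<le> k" "k < p" for j k
      using adm inc[OF that] mem[of j] mem[of k] that
      by (simp add: admissible_weights_def MON_def)
    show "0 \<le> b (\<sigma> k) \<and> b (\<sigma> k) \<le> 1" if "k < p" for k
      using adm mem[OF that] by (simp add: admissible_weights_def)
  qed
  ultimately show ?thesis by simp
qed

text \<open>
  The squares $b_i^2 (y_i-\bar y)^2$ occur in both functions and cancel, so the difference is affine
  in the weights. The first summand is free of them and will drop out when two choices of
  weights are compared.
\<close>
lemma loss_minus_URE_G:
  fixes y \<theta> \<tau> b :: "nat \<Rightarrow> real" and \<nu>0 \<nu>1 \<nu>2 :: real
  defines "W \<equiv> \<lambda>i. quad_var \<nu>0 \<nu>1 \<nu>2 (y i) / (\<tau> i + \<nu>2)"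
  shows "loss p \<theta> (shrink p b y) - URE_G \<nu>0 \<nu>1 \<nu>2 \<tau> p y b
    = 1 / real p * (\<Sum>i=1..p. (y i - \<theta> i)\<^sup>2 - W i)
      + 2 / real p * ((\<Sum>i=1..p. b i * (W i - y i * (y i - \<theta> i)))
          + grand_mean p y * (\<Sum>i=1..p. b i * (y i - \<theta> i))
          - 1 / real p * (\<Sum>i=1..p. b i * W i))"
proof -
  let ?m = "grand_mean p y" and ?q = "1 / real p"
  have "loss p \<theta> (shrink p b y) - URE_G \<nu>0 \<nu>1 \<nu>2 \<tau> p y b
    = ?q * (\<Sum>i=1..p. (shrink p b y i - \<theta> i)\<^sup>2
        - ((b i)\<^sup>2 * (y i - ?m)\<^sup>2 + (1 - 2 * (1 - ?q) * b i) * W i))"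
    unfolding loss_def URE_G_def W_def sum_subtractf right_diff_distrib by simp
  also have "(\<Sum>i=1..p. (shrink p b y i - \<theta> i)\<^sup>2
        - ((b i)\<^sup>2 * (y i - ?m)\<^sup>2 + (1 - 2 * (1 - ?q) * b i) * W i))
    = (\<Sum>i=1..p. ((y i - \<theta> i)\<^sup>2 - W i) + 2 * (b i * (W i - y i * (y i - \<theta> i)))
        + 2 * (?m * (b i * (y i - \<theta> i))) - 2 * (?q * (b i * W i)))"
    by (intro sum.cong refl) (simp add: shrink_def power2_eq_square algebra_simps)
  also have "\<dots> = (\<Sum>i=1..p. (y i - \<theta> i)\<^sup>2 - W i)
      + 2 * (\<Sum>i=1..p. b i * (W i - y i * (y i - \<theta> i)))
      + 2 * (?m * (\<Sum>i=1..p. b i * (y i - \<theta> i))) - 2 * (?q * (\<Sum>i=1..p. b i * W i))"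
    by (simp only: sum.distrib sum_subtractf sum_distrib_left)
  finally show ?thesis by (simp add: algebra_simps)
qed

text \<open>
  A bound, uniform over admissible weights, for half of the part of
  $l_p - \mathrm{URE}^G$ that depends on the weights; \<open>\<sigma>\<close> enumerates the indices by increasing \<open>\<tau>\<close>.
\<close>
definition URE_gap_bound ::
  "real \<Rightarrow> real \<Rightarrow> real \<Rightarrow> (nat \<Rightarrow> real) \<Rightarrow> (nat \<Rightarrow> nat) \<Rightarrow> nat \<Rightarrow> (nat \<Rightarrow> real) \<Rightarrow> (nat \<Rightarrow> real) \<Rightarrow> real" where
  "URE_gap_bound \<nu>0 \<nu>1 \<nu>2 \<tau> \<sigma> p \<theta> y = 1 / real p *
    (max_partial_sum (\<lambda>k. quad_var \<nu>0 \<nu>1 \<nu>2 (y (\<sigma> k)) / (\<tau> (\<sigma> k) + \<nu>2) - y (\<sigma> k) * (y (\<sigma> k) - \<theta> (\<sigma> k))) p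
     + \<bar>grand_mean p y\<bar> * max_partial_sum (\<lambda>k. y (\<sigma> k) - \<theta> (\<sigma> k)) p
     + 1 / real p * (\<Sum>i=1..p. \<bar>quad_var \<nu>0 \<nu>1 \<nu>2 (y i) / (\<tau> i + \<nu>2)\<bar>))"

text \<open>
  The loss is traded for the risk estimate and back, at a cost of twice the bound for each of
  the two weight vectors.
\<close>
lemma loss_le_of_URE_G_le:
  assumes adm: "admissible_weights p \<tau> b" "admissible_weights p \<tau> b'"
    and le: "URE_G \<nu>0 \<nu>1 \<nu>2 \<tau> p y b \<le> URE_G \<nu>0 \<nu>1 \<nu>2 \<tau> p y b'"
    and bij: "bij_betw \<sigma> {..<p} {1..p}"
    and inc: "\<And>j k. j \<le> k \<Longrightarrow> k < p \<Longrightarrow> \<tau> (\<sigma> j) \<le> \<tau> (\<sigma> k)"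
  shows "loss p \<theta> (shrink p b y)
    \<le> loss p \<theta> (shrink p b' y) + 4 * URE_gap_bound \<nu>0 \<nu>1 \<nu>2 \<tau> \<sigma> p \<theta> y"
proof -
  define W where "W i = quad_var \<nu>0 \<nu>1 \<nu>2 (y i) / (\<tau> i + \<nu>2)" for i
  define D where "D b = (\<Sum>i=1..p. b i * (W i - y i * (y i - \<theta> i)))
          + grand_mean p y * (\<Sum>i=1..p. b i * (y i - \<theta> i))
          - 1 / real p * (\<Sum>i=1..p. b i * W i)" for b
  have D: "\<bar>1 / real p * D b\<bar> \<le> URE_gap_bound \<nu>0 \<nu>1 \<nu>2 \<tau> \<sigma> p \<theta> y" if b: "admissible_weights p \<tau> b" for b
  proof -
    note le_max = admissible_weighted_sum_le[OF b bij inc]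
    have "\<bar>\<Sum>i=1..p. b i * W i\<bar> \<le> (\<Sum>i=1..p. \<bar>W i\<bar>)"
    proof (rule order_trans[OF sum_abs sum_mono])
      show "\<bar>b i * W i\<bar> \<le> \<bar>W i\<bar>" if "i \<in> {1..p}" for i
        using b that by (auto simp: admissible_weights_def abs_mult intro!: mult_left_le_one_le)
    qed
    then have "\<bar>1 / real p * (\<Sum>i=1..p. b i * W i)\<bar> \<le> 1 / real p * (\<Sum>i=1..p. \<bar>W i\<bar>)"
      by (simp add: abs_mult divide_right_mono)
    moreover have "\<bar>grand_mean p y * (\<Sum>i=1..p. b i * (y i - \<theta> i))\<bar>
        \<le> \<bar>grand_mean p y\<bar> * max_partial_sum (\<lambda>k. y (\<sigma> k) - \<theta> (\<sigma> k)) p"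
      unfolding abs_mult by (intro mult_left_mono le_max) auto
    moreover have "\<bar>\<Sum>i=1..p. b i * (W i - y i * (y i - \<theta> i))\<bar>
        \<le> max_partial_sum (\<lambda>k. W (\<sigma> k) - y (\<sigma> k) * (y (\<sigma> k) - \<theta> (\<sigma> k))) p"
      by (rule le_max)
    ultimately have "\<bar>D b\<bar> \<le> max_partial_sum (\<lambda>k. W (\<sigma> k) - y (\<sigma> k) * (y (\<sigma> k) - \<theta> (\<sigma> k))) p
        + \<bar>grand_mean p y\<bar> * max_partial_sum (\<lambda>k. y (\<sigma> k) - \<theta> (\<sigma> k)) p
        + 1 / real p * (\<Sum>i=1..p. \<bar>W i\<bar>)"
      unfolding D_def by linarith
    then have "1 / real p * \<bar>D b\<bar> \<le> URE_gap_bound \<nu>0 \<nu>1 \<nu>2 \<tau> \<sigma> p \<theta> y"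
      unfolding URE_gap_bound_def W_def by (intro mult_left_mono) auto
    then show ?thesis by (simp add: abs_mult)
  qed
  have gap: "loss p \<theta> (shrink p b y) - URE_G \<nu>0 \<nu>1 \<nu>2 \<tau> p y b
    = 1 / real p * (\<Sum>i=1..p. (y i - \<theta> i)\<^sup>2 - W i) + 2 * (1 / real p * D b)" for b
    using loss_minus_URE_G[of p \<theta> b y \<nu>0 \<nu>1 \<nu>2 \<tau>] by (simp add: D_def W_def)
  show ?thesis
    using gap[of b] gap[of b'] D[OF adm(1)] D[OF adm(2)] le by linarith
qed

lemma grand_mean_sq_le:
  assumes "1 \<le> p"
  shows "(grand_mean p y)\<^sup>2 \<le> Max ((\<lambda>i. (y i)\<^sup>2) ` {1..p})"
proof -
  let ?K = "Max ((\<lambda>i. (y i)\<^sup>2) ` {1..p})"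
  have le: "\<bar>y i\<bar> \<le> sqrt ?K" if "i \<in> {1..p}" for i
    using that by (intro real_le_rsqrt) auto
  have "\<bar>\<Sum>i=1..p. y i\<bar> \<le> (\<Sum>i=1..p. sqrt ?K)"
    by (rule order_trans[OF sum_abs sum_mono]) (rule le)
  then have "\<bar>\<Sum>i=1..p. y i\<bar> \<le> real p * sqrt ?K" by simp
  then have "\<bar>grand_mean p y\<bar> \<le> sqrt ?K"
    using assms by (simp add: grand_mean_def abs_mult field_simps)
  moreover have "0 \<le> ?K"
    using assms by (intro order_trans[OF zero_le_power2 Max_ge]) (auto intro!: imageI[where x = 1])
  ultimately show ?thesis
    by (metis abs_ge_zero power2_abs power_mono real_sqrt_pow2)
qed

lemma URE_gap_bound_nonneg: "0 \<le> URE_gap_bound \<nu>0 \<nu>1 \<nu>2 \<tau> \<sigma> p \<theta> y"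
  unfolding URE_gap_bound_def
  by (intro mult_nonneg_nonneg add_nonneg_nonneg max_partial_sum_nonneg sum_nonneg) auto

section \<open>Real bounds from finite suprema\<close>

lemma limsup_finite_imp_eventually_le:
  fixes f :: "nat \<Rightarrow> real"
  assumes "limsup (\<lambda>p. ereal (f p)) < \<infinity>"
  obtains K where "eventually (\<lambda>p. f p \<le> K) sequentially"
proof -
  obtain r where "limsup (\<lambda>p. ereal (f p)) < ereal r"
    using less_PInf_Ex_of_nat assms by auto
  then have "eventually (\<lambda>p. ereal (f p) < ereal r) sequentially" by (rule Limsup_lessD)
  then show thesis by (intro that[of r]) (auto elim: eventually_mono)
qed

lemma SUP_finite_imp_le:
  fixes f :: "'i \<Rightarrow> real"
  assumes "(SUP i\<in>I. ereal (f i)) < \<infinity>"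
  obtains K where "\<forall>i\<in>I. f i \<le> K"
proof -
  obtain r where r: "(SUP i\<in>I. ereal (f i)) < ereal r"
    using less_PInf_Ex_of_nat assms by auto
  show thesis
  proof (rule that)
    show "\<forall>i\<in>I. f i \<le> r"
      using le_less_trans[OF SUP_upper r] by (auto intro: less_imp_le)
  qed
qed

section \<open>Moments under a quadratic variance function\<close>

lemma (in prob_space) square_integrable_diff_const:
  fixes f :: "'a \<Rightarrow> real"
  assumes "integrable M f" "integrable M (\<lambda>\<omega>. (f \<omega>)\<^sup>2)"
  shows "integrable M (\<lambda>\<omega>. (f \<omega> - c)\<^sup>2)"
  unfolding power2_diff using assms by (auto simp: mult.commute mult.left_commute)

lemma sq_sum3_le: "(a - b + c)\<^sup>2 \<le> 3 * (a\<^sup>2 + b\<^sup>2 + (c::real)\<^sup>2)"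
proof -
  have "0 \<le> (a + b)\<^sup>2 + (b + c)\<^sup>2 + (a - c)\<^sup>2" by simp
  then show ?thesis by (simp add: power2_eq_square algebra_simps)
qed

locale quadratic_variance_model = prob_space M
  for M :: "'a measure" +
  fixes Y :: "nat \<Rightarrow> 'a \<Rightarrow> real" and \<theta> \<tau> :: "nat \<Rightarrow> real" and \<nu>0 \<nu>1 \<nu>2 :: real
  assumes tau_pos: "\<And>i. i \<ge> 1 \<Longrightarrow> \<tau> i > 0"
    and tau_nu2: "\<And>i. i \<ge> 1 \<Longrightarrow> \<tau> i + \<nu>2 \<noteq> 0"
    and indep: "indep_vars (\<lambda>_. borel) Y {1..}"
    and int1: "\<And>i. i \<ge> 1 \<Longrightarrow> integrable M (Y i)"
    and mean: "\<And>i. i \<ge> 1 \<Longrightarrow> expectation (Y i) = \<theta> i"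
    and int2: "\<And>i. i \<ge> 1 \<Longrightarrow> integrable M (\<lambda>\<omega>. (Y i \<omega>)\<^sup>2)"
    and var: "\<And>i. i \<ge> 1 \<Longrightarrow> variance (Y i) = quad_var \<nu>0 \<nu>1 \<nu>2 (\<theta> i) / \<tau> i"
    and int4: "\<And>i. i \<ge> 1 \<Longrightarrow> integrable M (\<lambda>\<omega>. (Y i \<omega>) ^ 4)"
begin

definition var_est :: "nat \<Rightarrow> 'a \<Rightarrow> real" where
  "var_est i \<omega> = quad_var \<nu>0 \<nu>1 \<nu>2 (Y i \<omega>) / (\<tau> i + \<nu>2)"

text \<open>
  The error of the variance estimate relative to $Y_i (Y_i - \theta_i)$, which also has
  expectation $\mathrm{Var}(Y_i)$.
\<close>
definition noise :: "nat \<Rightarrow> 'a \<Rightarrow> real" where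
  "noise i \<omega> = var_est i \<omega> - Y i \<omega> * (Y i \<omega> - \<theta> i)"

lemma meas: "i \<ge> 1 \<Longrightarrow> Y i \<in> borel_measurable M"
  using int1 by (rule borel_measurable_integrable)

lemma int_dev_sq: "i \<ge> 1 \<Longrightarrow> integrable M (\<lambda>\<omega>. (Y i \<omega> - \<theta> i)\<^sup>2)"
  by (intro square_integrable_diff_const int1 int2)

lemma var_eq: "i \<ge> 1 \<Longrightarrow> expectation (\<lambda>\<omega>. (Y i \<omega> - \<theta> i)\<^sup>2) = variance (Y i)"
  by (simp add: mean)

lemma second_moment: "i \<ge> 1 \<Longrightarrow> expectation (\<lambda>\<omega>. (Y i \<omega>)\<^sup>2) = (\<theta> i)\<^sup>2 + variance (Y i)"
  using variance_eq[OF int1 int2] by (simp add: mean)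

lemma int_sq_dev_sq: "i \<ge> 1 \<Longrightarrow> integrable M (\<lambda>\<omega>. ((Y i \<omega>)\<^sup>2 - c)\<^sup>2)"
  using int2 int4 by (intro square_integrable_diff_const) auto

text \<open>
  The constant terms cancel because $\tau_i \mathrm{Var}(Y_i) = V(\theta_i)$, which is the
  unbiasedness of the variance estimate. In this form the mean is visibly zero and the second
  moment is controlled by the variances in (A)--(C), with the coefficients bounded in (D).
\<close>
lemma noise_centred:
  assumes i: "i \<ge> 1"
  shows "noise i \<omega> = \<nu>1 / (\<tau> i + \<nu>2) * (Y i \<omega> - \<theta> i)
    - \<tau> i / (\<tau> i + \<nu>2) * ((Y i \<omega>)\<^sup>2 - expectation (\<lambda>\<omega>. (Y i \<omega>)\<^sup>2))
    + \<theta> i * (Y i \<omega> - \<theta> i)"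
proof -
  have "\<tau> i * variance (Y i) = \<nu>0 + \<nu>1 * \<theta> i + \<nu>2 * (\<theta> i)\<^sup>2"
    using var[OF i] tau_pos[OF i] by (simp add: quad_var_def)
  moreover have "inverse (\<tau> i + \<nu>2) * (\<tau> i + \<nu>2) = 1"
    using tau_nu2[OF i] by simp
  ultimately show ?thesis
    unfolding noise_def var_est_def second_moment[OF i] quad_var_def divide_inverse by algebra
qed

lemma noise_mean: "i \<ge> 1 \<Longrightarrow> expectation (noise i) = 0"
  using int1[of i] int2[of i] mean[of i] by (simp add: noise_centred ext[OF noise_centred] prob_space)

lemma noise_sq:
  assumes i: "i \<ge> 1"
  shows "integrable M (\<lambda>\<omega>. (noise i \<omega>)\<^sup>2)"
    and "expectation (\<lambda>\<omega>. (noise i \<omega>)\<^sup>2) \<le> 3 * ((\<nu>1 / (\<tau> i + \<nu>2))\<^sup>2 * variance (Y i)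
      + (\<tau> i / (\<tau> i + \<nu>2))\<^sup>2 * variance (\<lambda>\<omega>. (Y i \<omega>)\<^sup>2) + variance (Y i) * (\<theta> i)\<^sup>2)"
proof -
  let ?u = "\<nu>1 / (\<tau> i + \<nu>2)" and ?w = "\<tau> i / (\<tau> i + \<nu>2)" and ?e = "expectation (\<lambda>\<omega>. (Y i \<omega>)\<^sup>2)"
  let ?B = "\<lambda>\<omega>. 3 * (?u\<^sup>2 * (Y i \<omega> - \<theta> i)\<^sup>2 + ?w\<^sup>2 * ((Y i \<omega>)\<^sup>2 - ?e)\<^sup>2 + (\<theta> i)\<^sup>2 * (Y i \<omega> - \<theta> i)\<^sup>2)"
  have B: "integrable M ?B"
    using int_dev_sq[OF i] int_sq_dev_sq[OF i] by simp
  have le: "(noise i \<omega>)\<^sup>2 \<le> ?B \<omega>" for \<omega>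
    unfolding noise_centred[OF i] power_mult_distrib[symmetric] by (rule sq_sum3_le)
  have m: "noise i \<in> borel_measurable M"
    unfolding ext[OF noise_centred[OF i]] using meas[OF i] by measurable
  show int: "integrable M (\<lambda>\<omega>. (noise i \<omega>)\<^sup>2)"
    by (rule Bochner_Integration.integrable_bound[OF B]) (use m le in \<open>auto intro: order_trans[OF le]\<close>)
  have "expectation (\<lambda>\<omega>. (noise i \<omega>)\<^sup>2) \<le> expectation ?B"
    by (intro integral_mono int B le)
  also have "\<dots> = 3 * (?u\<^sup>2 * variance (Y i) + ?w\<^sup>2 * variance (\<lambda>\<omega>. (Y i \<omega>)\<^sup>2) + variance (Y i) * (\<theta> i)\<^sup>2)"
    using int_dev_sq[OF i] int_sq_dev_sq[OF i, of ?e] by (simp add: mean[OF i])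
  finally show "expectation (\<lambda>\<omega>. (noise i \<omega>)\<^sup>2) \<le> \<dots>" .
qed

lemma var_est_abs:
  assumes i: "i \<ge> 1"
  shows "integrable M (\<lambda>\<omega>. \<bar>var_est i \<omega>\<bar>)"
    and "expectation (\<lambda>\<omega>. \<bar>var_est i \<omega>\<bar>) \<le> 1 + expectation (\<lambda>\<omega>. (noise i \<omega>)\<^sup>2)
      + variance (Y i) + variance (Y i) * (\<theta> i)\<^sup>2"
proof -
  let ?B = "\<lambda>\<omega>. 1 + (noise i \<omega>)\<^sup>2 + (Y i \<omega> - \<theta> i)\<^sup>2 + (Y i \<omega> - \<theta> i)\<^sup>2 * (\<theta> i)\<^sup>2"
  have B: "integrable M ?B"
    using int_dev_sq[OF i] noise_sq[OF i] by simp
  have half: "\<bar>x\<bar> \<le> 1 / 2 + x\<^sup>2 / 2" for x :: real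
    using sum_squares_bound[of 1 "\<bar>x\<bar>"] by simp
  have le: "\<bar>var_est i \<omega>\<bar> \<le> ?B \<omega>" for \<omega>
  proof -
    have "var_est i \<omega> = noise i \<omega> + ((Y i \<omega> - \<theta> i)\<^sup>2 + (Y i \<omega> - \<theta> i) * \<theta> i)"
      by (simp add: noise_def power2_eq_square algebra_simps)
    then have "\<bar>var_est i \<omega>\<bar> \<le> \<bar>noise i \<omega>\<bar> + ((Y i \<omega> - \<theta> i)\<^sup>2 + \<bar>(Y i \<omega> - \<theta> i) * \<theta> i\<bar>)"
      by (smt (verit) zero_le_power2)
    also have "\<dots> \<le> (1 / 2 + (noise i \<omega>)\<^sup>2 / 2) + ((Y i \<omega> - \<theta> i)\<^sup>2 + (1 / 2 + ((Y i \<omega> - \<theta> i) * \<theta> i)\<^sup>2 / 2))"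
      by (intro add_mono half order_refl)
    also have "\<dots> \<le> ?B \<omega>"
      using zero_le_power2[of "noise i \<omega>"] zero_le_power2[of "(Y i \<omega> - \<theta> i) * \<theta> i"]
      unfolding power_mult_distrib by linarith
    finally show ?thesis .
  qed
  have m: "var_est i \<in> borel_measurable M"
    unfolding var_est_def[abs_def] quad_var_def using meas[OF i] by measurable
  show int: "integrable M (\<lambda>\<omega>. \<bar>var_est i \<omega>\<bar>)"
    by (rule Bochner_Integration.integrable_bound[OF B]) (use m le in \<open>auto intro: order_trans[OF le]\<close>)
  have "expectation (\<lambda>\<omega>. \<bar>var_est i \<omega>\<bar>) \<le> expectation ?B"
    by (intro integral_mono int B le)
  also have "\<dots> = 1 + expectation (\<lambda>\<omega>. (noise i \<omega>)\<^sup>2) + variance (Y i) + variance (Y i) * (\<theta> i)\<^sup>2"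
    using int_dev_sq[OF i] noise_sq[OF i] by (simp add: mean[OF i] prob_space)
  finally show "expectation (\<lambda>\<omega>. \<bar>var_est i \<omega>\<bar>) \<le> \<dots>" .
qed

section \<open>Expected size of the gap\<close>

lemma maximal_inequality_enumerated:
  fixes X :: "nat \<Rightarrow> 'a \<Rightarrow> real"
  assumes bij: "bij_betw \<sigma> {..<p} {1..p}"
    and f: "\<And>i. f i \<in> borel_measurable borel" and X: "\<And>i \<omega>. X i \<omega> = f i (Y i \<omega>)"
    and sq: "\<And>i. i \<ge> 1 \<Longrightarrow> integrable M (\<lambda>\<omega>. (X i \<omega>)\<^sup>2)"
    and mean0: "\<And>i. i \<ge> 1 \<Longrightarrow> expectation (X i) = 0"
  shows "integrable M (\<lambda>\<omega>. (max_partial_sum (\<lambda>k. X (\<sigma> k) \<omega>) p)\<^sup>2)"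
    and "(\<lambda>\<omega>. max_partial_sum (\<lambda>k. X (\<sigma> k) \<omega>) p) \<in> borel_measurable M"
    and "expectation (\<lambda>\<omega>. (max_partial_sum (\<lambda>k. X (\<sigma> k) \<omega>) p)\<^sup>2)
      \<le> 4 * (\<Sum>i=1..p. expectation (\<lambda>\<omega>. (X i \<omega>)\<^sup>2))"
proof -
  have mem: "\<sigma> k \<ge> 1" if "k < p" for k
    using bij that by (auto simp: bij_betw_def)
  have "indep_vars (\<lambda>_. borel) (\<lambda>i \<omega>. f i (Y i \<omega>)) {1..}"
    by (rule indep_vars_compose2[OF indep]) (use f in auto)
  then have "indep_vars (\<lambda>_. borel) X {1..}" by (simp add: X[abs_def])
  then have ind: "indep_vars (\<lambda>_. borel) (\<lambda>k. X (\<sigma> k)) {..<p}"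
    by (rule indep_vars_reindex) (use bij mem in \<open>auto simp: bij_betw_def\<close>)
  then have m: "X (\<sigma> k) \<in> borel_measurable M" if "k < p" for k
    using that by (auto simp: indep_vars_def)
  show "integrable M (\<lambda>\<omega>. (max_partial_sum (\<lambda>k. X (\<sigma> k) \<omega>) p)\<^sup>2)"
    by (intro integrable_max_partial_sum_sq m sq mem)
  show "(\<lambda>\<omega>. max_partial_sum (\<lambda>k. X (\<sigma> k) \<omega>) p) \<in> borel_measurable M"
    by (intro max_partial_sum_measurable m)
  have "expectation (\<lambda>\<omega>. (max_partial_sum (\<lambda>k. X (\<sigma> k) \<omega>) p)\<^sup>2)
      \<le> 4 * (\<Sum>k<p. expectation (\<lambda>\<omega>. (X (\<sigma> k) \<omega>)\<^sup>2))"
    by (intro L2_maximal_inequality ind sq mean0 mem)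
  also have "(\<Sum>k<p. expectation (\<lambda>\<omega>. (X (\<sigma> k) \<omega>)\<^sup>2)) = (\<Sum>i=1..p. expectation (\<lambda>\<omega>. (X i \<omega>)\<^sup>2))"
    by (rule sum.reindex_bij_betw[OF bij])
  finally show "expectation (\<lambda>\<omega>. (max_partial_sum (\<lambda>k. X (\<sigma> k) \<omega>) p)\<^sup>2)
      \<le> 4 * (\<Sum>i=1..p. expectation (\<lambda>\<omega>. (X i \<omega>)\<^sup>2))" .
qed

lemma integrable_Max_sq:
  assumes "1 \<le> p"
  shows "integrable M (\<lambda>\<omega>. Max ((\<lambda>i. (Y i \<omega>)\<^sup>2) ` {1..p}))"
  using assms by (intro integrable_MAX int2) auto

text \<open>
  The free parameters \<open>a\<close> and \<open>d\<close> come from $2xy \le c x^2 + y^2/c$, used in place of the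
  Cauchy--Schwarz inequality so that only second moments of the maxima and of the grand mean appear.
  They are chosen later as powers of $p$ that balance the two halves.
\<close>
lemma URE_gap_bound_expectation:
  assumes p: "1 \<le> p" and bij: "bij_betw \<sigma> {..<p} {1..p}" and a: "a > 0" and d: "d > 0"
  shows "integrable M (\<lambda>\<omega>. URE_gap_bound \<nu>0 \<nu>1 \<nu>2 \<tau> \<sigma> p \<theta> (\<lambda>i. Y i \<omega>))"
    and "expectation (\<lambda>\<omega>. URE_gap_bound \<nu>0 \<nu>1 \<nu>2 \<tau> \<sigma> p \<theta> (\<lambda>i. Y i \<omega>)) \<le> 1 / real p *
     ((a + 4 * (\<Sum>i=1..p. expectation (\<lambda>\<omega>. (noise i \<omega>)\<^sup>2)) / a) / 2
      + (d * expectation (\<lambda>\<omega>. Max ((\<lambda>i. (Y i \<omega>)\<^sup>2) ` {1..p})) + 4 * (\<Sum>i=1..p. variance (Y i)) / d) / 2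
      + 1 / real p * (\<Sum>i=1..p. 1 + expectation (\<lambda>\<omega>. (noise i \<omega>)\<^sup>2) + variance (Y i) + variance (Y i) * (\<theta> i)\<^sup>2))"
proof -
  let ?H = "\<lambda>\<omega>. URE_gap_bound \<nu>0 \<nu>1 \<nu>2 \<tau> \<sigma> p \<theta> (\<lambda>i. Y i \<omega>)"
  let ?mN = "\<lambda>\<omega>. max_partial_sum (\<lambda>k. noise (\<sigma> k) \<omega>) p"
  let ?mY = "\<lambda>\<omega>. max_partial_sum (\<lambda>k. Y (\<sigma> k) \<omega> - \<theta> (\<sigma> k)) p"
  let ?g = "\<lambda>\<omega>. grand_mean p (\<lambda>i. Y i \<omega>)"
  let ?Max = "\<lambda>\<omega>. Max ((\<lambda>i. (Y i \<omega>)\<^sup>2) ` {1..p})"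
  let ?V = "\<lambda>\<omega>. \<Sum>i=1..p. \<bar>var_est i \<omega>\<bar>"
  have H: "?H \<omega> = 1 / real p * (?mN \<omega> + \<bar>?g \<omega>\<bar> * ?mY \<omega> + 1 / real p * ?V \<omega>)" for \<omega>
    by (simp add: URE_gap_bound_def noise_def var_est_def)
  define f where "f i y = quad_var \<nu>0 \<nu>1 \<nu>2 y / (\<tau> i + \<nu>2) - y * (y - \<theta> i)" for i y
  have f: "f i \<in> borel_measurable borel" for i
    unfolding f_def quad_var_def by measurable
  have noise_f: "noise i \<omega> = f i (Y i \<omega>)" for i \<omega>
    by (simp add: noise_def var_est_def f_def)
  have noise: "integrable M (\<lambda>\<omega>. (?mN \<omega>)\<^sup>2)" "?mN \<in> borel_measurable M"
    "expectation (\<lambda>\<omega>. (?mN \<omega>)\<^sup>2) \<le> 4 * (\<Sum>i=1..p. expectation (\<lambda>\<omega>. (noise i \<omega>)\<^sup>2))"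
    using maximal_inequality_enumerated[where f = f and X = noise, OF bij f noise_f noise_sq(1) noise_mean]
    by simp_all
  have dev0: "expectation (\<lambda>\<omega>. Y i \<omega> - \<theta> i) = 0" if "i \<ge> 1" for i
    using that int1 by (simp add: mean prob_space)
  have Yd: "integrable M (\<lambda>\<omega>. (?mY \<omega>)\<^sup>2)" "?mY \<in> borel_measurable M"
    "expectation (\<lambda>\<omega>. (?mY \<omega>)\<^sup>2) \<le> 4 * (\<Sum>i=1..p. expectation (\<lambda>\<omega>. (Y i \<omega> - \<theta> i)\<^sup>2))"
    using maximal_inequality_enumerated[OF bij, where X = "\<lambda>i \<omega>. Y i \<omega> - \<theta> i" and f = "\<lambda>i y. y - \<theta> i"]
      int_dev_sq dev0 by auto
  have g: "?g \<in> borel_measurable M"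
    unfolding grand_mean_def by (intro borel_measurable_times borel_measurable_const borel_measurable_sum meas) auto
  have V: "integrable M ?V"
    by (intro Bochner_Integration.integrable_sum var_est_abs) auto
  let ?B = "\<lambda>\<omega>. 1 / real p * ((a + (?mN \<omega>)\<^sup>2 / a) / 2 + (d * ?Max \<omega> + (?mY \<omega>)\<^sup>2 / d) / 2 + 1 / real p * ?V \<omega>)"
  have B: "integrable M ?B"
    using noise(1) Yd(1) V integrable_Max_sq[OF p] by simp
  have le: "?H \<omega> \<le> ?B \<omega>" for \<omega>
  proof -
    have amgm: "x * y \<le> (c * x\<^sup>2 + y\<^sup>2 / c) / 2" if "c > 0" for c x y :: real
    proof -
      have "0 \<le> (c * x - y)\<^sup>2 / c" using that by simp
      also have "(c * x - y)\<^sup>2 / c = c * x\<^sup>2 + y\<^sup>2 / c - 2 * (x * y)"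
        using that by (simp add: power2_eq_square field_simps)
      finally show ?thesis by simp
    qed
    have "?mN \<omega> \<le> (a + (?mN \<omega>)\<^sup>2 / a) / 2" using amgm[OF a, of 1 "?mN \<omega>"] by simp
    moreover have "\<bar>?g \<omega>\<bar> * ?mY \<omega> \<le> (d * \<bar>?g \<omega>\<bar>\<^sup>2 + (?mY \<omega>)\<^sup>2 / d) / 2"
      by (rule amgm[OF d])
    moreover have "d * \<bar>?g \<omega>\<bar>\<^sup>2 \<le> d * ?Max \<omega>"
      using d grand_mean_sq_le[OF p, of "\<lambda>i. Y i \<omega>"] by (intro mult_left_mono) auto
    ultimately have "?mN \<omega> + \<bar>?g \<omega>\<bar> * ?mY \<omega> + 1 / real p * ?V \<omega>
      \<le> (a + (?mN \<omega>)\<^sup>2 / a) / 2 + (d * ?Max \<omega> + (?mY \<omega>)\<^sup>2 / d) / 2 + 1 / real p * ?V \<omega>"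
      by argo
    then show ?thesis unfolding H by (intro mult_left_mono) auto
  qed
  show int: "integrable M ?H"
  proof (rule Bochner_Integration.integrable_bound[OF B])
    show "?H \<in> borel_measurable M"
      unfolding H using noise(2) Yd(2) g borel_measurable_integrable[OF V] by measurable
    show "AE \<omega> in M. norm (?H \<omega>) \<le> norm (?B \<omega>)"
      using le URE_gap_bound_nonneg by (intro AE_I2) (smt (verit) real_norm_def)
  qed
  have VE: "expectation ?V \<le> (\<Sum>i=1..p. 1 + expectation (\<lambda>\<omega>. (noise i \<omega>)\<^sup>2) + variance (Y i) + variance (Y i) * (\<theta> i)\<^sup>2)"
    using var_est_abs by (subst Bochner_Integration.integral_sum) (auto intro!: sum_mono)
  have "expectation ?H \<le> expectation ?B"
    by (intro integral_mono int B le)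
  also have "\<dots> = 1 / real p * ((a + expectation (\<lambda>\<omega>. (?mN \<omega>)\<^sup>2) / a) / 2
      + (d * expectation ?Max + expectation (\<lambda>\<omega>. (?mY \<omega>)\<^sup>2) / d) / 2 + 1 / real p * expectation ?V)"
    using noise(1) Yd(1) V integrable_Max_sq[OF p] by (simp add: prob_space)
  also have "\<dots> \<le> 1 / real p *
     ((a + 4 * (\<Sum>i=1..p. expectation (\<lambda>\<omega>. (noise i \<omega>)\<^sup>2)) / a) / 2
      + (d * expectation ?Max + 4 * (\<Sum>i=1..p. variance (Y i)) / d) / 2
      + 1 / real p * (\<Sum>i=1..p. 1 + expectation (\<lambda>\<omega>. (noise i \<omega>)\<^sup>2) + variance (Y i) + variance (Y i) * (\<theta> i)\<^sup>2))"
    using noise(3) Yd(3) VE a d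
    by (intro mult_left_mono add_mono divide_right_mono order_refl) (auto simp: var_eq)
  finally show "expectation ?H \<le> \<dots>" .
qed

text \<open>
  Integrals of non-integrable functions are zero by convention, so the risks can be compared through
  the losses only once the losses are known to be integrable.
\<close>
lemma integrable_loss_shrink:
  assumes p: "1 \<le> p" and B: "random_weights M p \<tau> B"
  shows "integrable M (\<lambda>\<omega>. loss p \<theta> (shrink p (B \<omega>) (\<lambda>i. Y i \<omega>)))"
  unfolding loss_def
proof (intro integrable_mult_right Bochner_Integration.integrable_sum)
  fix i assume i: "i \<in> {1..p}"
  let ?g = "\<lambda>\<omega>. grand_mean p (\<lambda>i. Y i \<omega>)"
  let ?D = "\<lambda>\<omega>. 2 * (Y i \<omega> - \<theta> i)\<^sup>2 + 4 * (Y i \<omega>)\<^sup>2 + 4 * Max ((\<lambda>i. (Y i \<omega>)\<^sup>2) ` {1..p})"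
  have "integrable M ?D"
    using i int_dev_sq[of i] int2[of i] integrable_Max_sq[OF p] by simp
  then show "integrable M (\<lambda>\<omega>. (shrink p (B \<omega>) (\<lambda>i. Y i \<omega>) i - \<theta> i)\<^sup>2)"
  proof (rule Bochner_Integration.integrable_bound)
    have g: "?g \<in> borel_measurable M"
      unfolding grand_mean_def by (intro borel_measurable_times borel_measurable_const borel_measurable_sum meas) auto
    have Bi: "(\<lambda>\<omega>. B \<omega> i) \<in> borel_measurable M"
      using B i by (simp add: random_weights_def)
    have Yi: "Y i \<in> borel_measurable M" using i by (simp add: meas)
    show "(\<lambda>\<omega>. (shrink p (B \<omega>) (\<lambda>i. Y i \<omega>) i - \<theta> i)\<^sup>2) \<in> borel_measurable M"
      unfolding shrink_def using g Bi Yi by measurable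
    show "AE \<omega> in M. norm ((shrink p (B \<omega>) (\<lambda>i. Y i \<omega>) i - \<theta> i)\<^sup>2) \<le> norm (?D \<omega>)"
    proof (rule AE_I2)
      fix \<omega> assume \<omega>: "\<omega> \<in> space M"
      let ?b = "B \<omega> i"
      have b: "0 \<le> ?b" "?b \<le> 1"
        using B i \<omega> by (auto simp: random_weights_def admissible_weights_def)
      have two: "(x - y)\<^sup>2 \<le> 2 * x\<^sup>2 + 2 * y\<^sup>2" for x y :: real
        using zero_le_power2[of "x + y"] by (simp add: power2_eq_square algebra_simps)
      have "?b\<^sup>2 \<le> 1\<^sup>2" by (intro power_mono b)
      then have "?b\<^sup>2 * (Y i \<omega> - ?g \<omega>)\<^sup>2 \<le> (Y i \<omega> - ?g \<omega>)\<^sup>2"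
        by (simp add: mult_left_le_one_le)
      moreover have "(shrink p (B \<omega>) (\<lambda>i. Y i \<omega>) i - \<theta> i)\<^sup>2 = ((Y i \<omega> - \<theta> i) - ?b * (Y i \<omega> - ?g \<omega>))\<^sup>2"
        by (simp add: shrink_def algebra_simps)
      moreover have "\<dots> \<le> 2 * (Y i \<omega> - \<theta> i)\<^sup>2 + 2 * (?b\<^sup>2 * (Y i \<omega> - ?g \<omega>)\<^sup>2)"
        using two[of "Y i \<omega> - \<theta> i" "?b * (Y i \<omega> - ?g \<omega>)"] by (simp add: power_mult_distrib)
      moreover have "(Y i \<omega> - ?g \<omega>)\<^sup>2 \<le> 2 * (Y i \<omega>)\<^sup>2 + 2 * (?g \<omega>)\<^sup>2" by (rule two)
      moreover have "(?g \<omega>)\<^sup>2 \<le> Max ((\<lambda>i. (Y i \<omega>)\<^sup>2) ` {1..p})"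
        by (rule grand_mean_sq_le[OF p])
      ultimately have "(shrink p (B \<omega>) (\<lambda>i. Y i \<omega>) i - \<theta> i)\<^sup>2 \<le> ?D \<omega>" by argo
      then show "norm ((shrink p (B \<omega>) (\<lambda>i. Y i \<omega>) i - \<theta> i)\<^sup>2) \<le> norm (?D \<omega>)" by simp
    qed
  qed
qed

section \<open>Asymptotics\<close>

lemma sum_noise_sq_le:
  assumes u: "\<And>i. i \<ge> 1 \<Longrightarrow> (\<nu>1 / (\<tau> i + \<nu>2))\<^sup>2 \<le> K"
    and w: "\<And>i. i \<ge> 1 \<Longrightarrow> (\<tau> i / (\<tau> i + \<nu>2))\<^sup>2 \<le> K"
  shows "(\<Sum>i=1..p. expectation (\<lambda>\<omega>. (noise i \<omega>)\<^sup>2)) \<le> 3 * (K * (\<Sum>i=1..p. variance (Y i))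
    + K * (\<Sum>i=1..p. variance (\<lambda>\<omega>. (Y i \<omega>)\<^sup>2)) + (\<Sum>i=1..p. variance (Y i) * (\<theta> i)\<^sup>2))"
proof -
  have "(\<Sum>i=1..p. expectation (\<lambda>\<omega>. (noise i \<omega>)\<^sup>2)) \<le> (\<Sum>i=1..p. 3 * (K * variance (Y i)
    + K * variance (\<lambda>\<omega>. (Y i \<omega>)\<^sup>2) + variance (Y i) * (\<theta> i)\<^sup>2))"
  proof (rule sum_mono)
    fix i assume "i \<in> {1..p}"
    then have i: "i \<ge> 1" by simp
    show "expectation (\<lambda>\<omega>. (noise i \<omega>)\<^sup>2) \<le> 3 * (K * variance (Y i)
      + K * variance (\<lambda>\<omega>. (Y i \<omega>)\<^sup>2) + variance (Y i) * (\<theta> i)\<^sup>2)"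
      by (rule order_trans[OF noise_sq(2)[OF i]], intro mult_left_mono add_mono mult_right_mono)
         (use u[OF i] w[OF i] in \<open>auto intro: variance_positive\<close>)
  qed
  also have "\<dots> = 3 * (K * (\<Sum>i=1..p. variance (Y i))
    + K * (\<Sum>i=1..p. variance (\<lambda>\<omega>. (Y i \<omega>)\<^sup>2)) + (\<Sum>i=1..p. variance (Y i) * (\<theta> i)\<^sup>2))"
    by (simp only: sum.distrib sum_distrib_left[symmetric])
  finally show ?thesis .
qed

text \<open>
  The choices $a = p^{1/2}$ and $d = p^{\varepsilon/2}$ balance the terms: the maxima have second
  moment $O(p)$ and the squared grand mean has expectation $O(p^{1-\varepsilon})$.
\<close>
lemma URE_gap_bound_expectation_le_powers:
  assumes p: "1 \<le> p" and bij: "bij_betw \<sigma> {..<p} {1..p}"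
    and A: "(\<Sum>i=1..p. variance (Y i)) \<le> K * real p"
    and C: "(\<Sum>i=1..p. variance (Y i) * (\<theta> i)\<^sup>2) \<le> K * real p"
    and L: "(\<Sum>i=1..p. expectation (\<lambda>\<omega>. (noise i \<omega>)\<^sup>2)) \<le> L * real p"
    and E: "expectation (\<lambda>\<omega>. Max ((\<lambda>i. (Y i \<omega>)\<^sup>2) ` {1..p})) \<le> K * real p powr (1 - \<epsilon>)"
  shows "expectation (\<lambda>\<omega>. URE_gap_bound \<nu>0 \<nu>1 \<nu>2 \<tau> \<sigma> p \<theta> (\<lambda>i. Y i \<omega>))
    \<le> (1 + 4 * L) / 2 * real p powr (-1/2) + 5 * K / 2 * real p powr (-\<epsilon>/2) + (1 + L + 2 * K) * real p powr (-1)"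
proof -
  let ?P = "real p"
  let ?a = "?P powr (1/2)" and ?d = "?P powr (\<epsilon>/2)"
  have P: "?P > 0" using p by simp
  have a: "?a > 0" and d: "?d > 0" using P by auto
  have "expectation (\<lambda>\<omega>. URE_gap_bound \<nu>0 \<nu>1 \<nu>2 \<tau> \<sigma> p \<theta> (\<lambda>i. Y i \<omega>)) \<le> 1 / ?P *
     ((?a + 4 * (\<Sum>i=1..p. expectation (\<lambda>\<omega>. (noise i \<omega>)\<^sup>2)) / ?a) / 2
      + (?d * expectation (\<lambda>\<omega>. Max ((\<lambda>i. (Y i \<omega>)\<^sup>2) ` {1..p})) + 4 * (\<Sum>i=1..p. variance (Y i)) / ?d) / 2
      + 1 / ?P * (\<Sum>i=1..p. 1 + expectation (\<lambda>\<omega>. (noise i \<omega>)\<^sup>2) + variance (Y i) + variance (Y i) * (\<theta> i)\<^sup>2))"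
    by (rule URE_gap_bound_expectation(2)[OF p bij a d])
  also have "\<dots> \<le> 1 / ?P * ((?a + 4 * (L * ?P) / ?a) / 2
      + (?d * (K * ?P powr (1 - \<epsilon>)) + 4 * (K * ?P) / ?d) / 2
      + 1 / ?P * (?P + L * ?P + K * ?P + K * ?P))"
  proof (intro mult_left_mono add_mono divide_right_mono order_refl E A L)
    show "(\<Sum>i=1..p. 1 + expectation (\<lambda>\<omega>. (noise i \<omega>)\<^sup>2) + variance (Y i) + variance (Y i) * (\<theta> i)\<^sup>2)
      \<le> ?P + L * ?P + K * ?P + K * ?P"
      unfolding sum.distrib using A C L by simp
  qed (use a d in auto)
  also have "\<dots> = (1 + 4 * L) / 2 * ?P powr (-1/2) + 5 * K / 2 * ?P powr (-\<epsilon>/2) + (1 + L + 2 * K) * ?P powr (-1)"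
  proof -
    have 1: "?P powr (-1/2) = ?a / ?P" "?P powr (-1/2) = 1 / ?a"
      using P powr_diff[of ?P "1/2" 1] powr_minus_divide[of ?P "1/2"] by simp_all
    have 2: "?d * ?P powr (1 - \<epsilon>) = ?P * ?P powr (-\<epsilon>/2)" "?P powr (-\<epsilon>/2) = 1 / ?d"
    proof -
      have "\<epsilon> / 2 + (1 - \<epsilon>) = 1 + - \<epsilon> / 2" by simp
      then show "?d * ?P powr (1 - \<epsilon>) = ?P * ?P powr (-\<epsilon>/2)"
        using P powr_add[of ?P "\<epsilon> / 2" "1 - \<epsilon>"] powr_add[of ?P 1 "- \<epsilon> / 2"] by simp
      show "?P powr (-\<epsilon>/2) = 1 / ?d" using powr_minus_divide[of ?P "\<epsilon>/2"] by simp
    qed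
    have 3: "?P powr (-1) = 1 / ?P" using P by (simp add: powr_minus_divide)
    have "1 / ?P * ((?a + 4 * (L * ?P) / ?a) / 2) = (?a / ?P + 4 * L * (1 / ?a)) / 2"
      using P a by (simp add: field_simps)
    also have "\<dots> = (?P powr (-1/2) + 4 * L * ?P powr (-1/2)) / 2"
      unfolding 1(1)[symmetric] 1(2)[symmetric] ..
    finally have h1: "1 / ?P * ((?a + 4 * (L * ?P) / ?a) / 2) = (1 + 4 * L) / 2 * ?P powr (-1/2)"
      by (simp add: algebra_simps)
    have h2: "1 / ?P * ((?d * (K * ?P powr (1 - \<epsilon>)) + 4 * (K * ?P) / ?d) / 2) = 5 * K / 2 * ?P powr (-\<epsilon>/2)"
    proof -
      have "1 / ?P * ((?P * z * K + 4 * (K * ?P) * z) / 2) = 5 * K / 2 * z" for z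
        using P by (simp add: field_simps)
      moreover have "?d * (K * ?P powr (1 - \<epsilon>)) = ?P * ?P powr (-\<epsilon>/2) * K"
        unfolding 2(1)[symmetric] by simp
      moreover have "4 * (K * ?P) / ?d = 4 * (K * ?P) * ?P powr (-\<epsilon>/2)"
        unfolding 2(2) by simp
      ultimately show ?thesis by (simp only:)
    qed
    have h3: "1 / ?P * (1 / ?P * (?P + L * ?P + K * ?P + K * ?P)) = (1 + L + 2 * K) * ?P powr (-1)"
      unfolding 3 using P by (simp add: field_simps)
    have "1 / ?P * (u + v + w) = 1 / ?P * u + 1 / ?P * v + 1 / ?P * w" for u v w
      by (simp add: distrib_left add_divide_distrib)
    then show ?thesis by (rule trans) (simp only: h1 h2 h3)
  qed
  finally show ?thesis .
qed

lemma URE_gap_bound_expectation_tendsto_0: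
  assumes bij: "\<And>p. bij_betw (\<sigma> p) {..<p} {1..p}"
    and condA: "limsup (\<lambda>p. ereal (1 / real p * (\<Sum>i=1..p. variance (Y i)))) < \<infinity>"
    and condB: "limsup (\<lambda>p. ereal (1 / real p * (\<Sum>i=1..p. variance (Y i) * (\<theta> i)\<^sup>2))) < \<infinity>"
    and condC: "limsup (\<lambda>p. ereal (1 / real p * (\<Sum>i=1..p. variance (\<lambda>\<omega>. (Y i \<omega>)\<^sup>2)))) < \<infinity>"
    and condD1: "(SUP i\<in>{1..}. ereal ((\<tau> i / (\<tau> i + \<nu>2))\<^sup>2)) < \<infinity>"
    and condD2: "(SUP i\<in>{1..}. ereal ((\<nu>1 / (\<tau> i + \<nu>2))\<^sup>2)) < \<infinity>"
    and \<epsilon>: "\<epsilon> > 0"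
    and condE: "limsup (\<lambda>p. ereal (1 / (real p powr (1 - \<epsilon>)) *
              expectation (\<lambda>\<omega>. Max ((\<lambda>i. (Y i \<omega>)\<^sup>2) ` {1..p})))) < \<infinity>"
  shows "(\<lambda>p. expectation (\<lambda>\<omega>. URE_gap_bound \<nu>0 \<nu>1 \<nu>2 \<tau> (\<sigma> p) p \<theta> (\<lambda>i. Y i \<omega>))) \<longlonglongrightarrow> 0"
proof -
  obtain KA where KA: "eventually (\<lambda>p. 1 / real p * (\<Sum>i=1..p. variance (Y i)) \<le> KA) sequentially"
    by (rule limsup_finite_imp_eventually_le[OF condA])
  obtain KB where KB: "eventually (\<lambda>p. 1 / real p * (\<Sum>i=1..p. variance (Y i) * (\<theta> i)\<^sup>2) \<le> KB) sequentially"
    by (rule limsup_finite_imp_eventually_le[OF condB])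
  obtain KC where KC: "eventually (\<lambda>p. 1 / real p * (\<Sum>i=1..p. variance (\<lambda>\<omega>. (Y i \<omega>)\<^sup>2)) \<le> KC) sequentially"
    by (rule limsup_finite_imp_eventually_le[OF condC])
  obtain KE where KE: "eventually (\<lambda>p. 1 / (real p powr (1 - \<epsilon>)) *
              expectation (\<lambda>\<omega>. Max ((\<lambda>i. (Y i \<omega>)\<^sup>2) ` {1..p})) \<le> KE) sequentially"
    by (rule limsup_finite_imp_eventually_le[OF condE])
  obtain KD where KD: "\<forall>i\<in>{1..}. (\<tau> i / (\<tau> i + \<nu>2))\<^sup>2 \<le> KD"
    by (rule SUP_finite_imp_le[OF condD1])
  obtain KD' where KD': "\<forall>i\<in>{1..}. (\<nu>1 / (\<tau> i + \<nu>2))\<^sup>2 \<le> KD'"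
    by (rule SUP_finite_imp_le[OF condD2])
  \<comment> \<open>One constant for all conditions; it is at least 1 so that it is nonnegative as a factor.\<close>
  define K where "K = Max {1, KA, KB, KC, KE, KD, KD'}"
  have K: "1 \<le> K" "KA \<le> K" "KB \<le> K" "KC \<le> K" "KE \<le> K" "KD \<le> K" "KD' \<le> K"
    unfolding K_def by (rule Max_ge; simp)+
  define L where "L = 3 * (K * K + K * K + K)"
  let ?R = "\<lambda>p. (1 + 4 * L) / 2 * real p powr (-1/2) + 5 * K / 2 * real p powr (-\<epsilon>/2)
    + (1 + L + 2 * K) * real p powr (-1)"
  have bound: "eventually (\<lambda>p. expectation (\<lambda>\<omega>. URE_gap_bound \<nu>0 \<nu>1 \<nu>2 \<tau> (\<sigma> p) p \<theta> (\<lambda>i. Y i \<omega>)) \<le> ?R p) sequentially"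
    using KA KB KC KE eventually_ge_at_top[of 1]
  proof eventually_elim
    case (elim p)
    have scale: "x \<le> K * s" if "1 / s * x \<le> k" "k \<le> K" "s > 0" for x s k
    proof -
      have "x / s \<le> K" using that by simp
      then show ?thesis using that by (simp add: pos_divide_le_eq)
    qed
    have A: "(\<Sum>i=1..p. variance (Y i)) \<le> K * real p"
      by (rule scale[OF elim(1) K(2)]) (use elim in simp)
    have C: "(\<Sum>i=1..p. variance (Y i) * (\<theta> i)\<^sup>2) \<le> K * real p"
      by (rule scale[OF elim(2) K(3)]) (use elim in simp)
    have F: "(\<Sum>i=1..p. variance (\<lambda>\<omega>. (Y i \<omega>)\<^sup>2)) \<le> K * real p"
      by (rule scale[OF elim(3) K(4)]) (use elim in simp)
    have E: "expectation (\<lambda>\<omega>. Max ((\<lambda>i. (Y i \<omega>)\<^sup>2) ` {1..p})) \<le> K * real p powr (1 - \<epsilon>)"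
      by (rule scale[OF elim(4) K(5)]) (use elim in simp)
    have "(\<Sum>i=1..p. expectation (\<lambda>\<omega>. (noise i \<omega>)\<^sup>2)) \<le> 3 * (K * (\<Sum>i=1..p. variance (Y i))
        + K * (\<Sum>i=1..p. variance (\<lambda>\<omega>. (Y i \<omega>)\<^sup>2)) + (\<Sum>i=1..p. variance (Y i) * (\<theta> i)\<^sup>2))"
      by (rule sum_noise_sq_le) (use KD KD' K in \<open>auto intro: order_trans\<close>)
    also have "\<dots> \<le> 3 * (K * (K * real p) + K * (K * real p) + K * real p)"
      using A C F K(1) by (intro mult_left_mono add_mono) auto
    also have "\<dots> = L * real p" by (simp add: L_def algebra_simps)
    finally have L: "(\<Sum>i=1..p. expectation (\<lambda>\<omega>. (noise i \<omega>)\<^sup>2)) \<le> L * real p" .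
    show ?case
      by (rule URE_gap_bound_expectation_le_powers[OF elim(5) bij A C L E])
  qed
  have "((\<lambda>p. real p powr s) \<longlongrightarrow> 0) sequentially" if "s < 0" for s
    by (rule tendsto_neg_powr[OF that filterlim_real_sequentially])
  from this[of "-1/2"] this[of "-\<epsilon>/2"] this[of "-1"]
  have "?R \<longlonglongrightarrow> (1 + 4 * L) / 2 * 0 + 5 * K / 2 * 0 + (1 + L + 2 * K) * 0"
    using \<epsilon> by (intro tendsto_intros) auto
  then have "?R \<longlonglongrightarrow> 0" by simp
  show ?thesis
    by (rule tendsto_sandwich[OF _ bound tendsto_const \<open>?R \<longlonglongrightarrow> 0\<close>])
       (intro always_eventually allI integral_nonneg_AE AE_I2 URE_gap_bound_nonneg)
qed

end

lemma SG_weights_imp: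
  assumes "SG_weights M \<nu>0 \<nu>1 \<nu>2 \<tau> p Y B"
  shows "random_weights M p \<tau> B"
    and "\<lbrakk>\<omega> \<in> space M; admissible_weights p \<tau> b\<rbrakk>
      \<Longrightarrow> URE_G \<nu>0 \<nu>1 \<nu>2 \<tau> p (\<lambda>i. Y i \<omega>) (B \<omega>) \<le> URE_G \<nu>0 \<nu>1 \<nu>2 \<tau> p (\<lambda>i. Y i \<omega>) b"
  using assms unfolding SG_weights_def random_weights_def is_arg_min_linorder by auto

theorem theorem2p4:
  fixes M :: "'a measure"
    and Y :: "nat \<Rightarrow> 'a \<Rightarrow> real"
    and \<theta> \<tau> :: "nat \<Rightarrow> real"
    and \<nu>0 \<nu>1 \<nu>2 :: real
    and \<Theta> :: "real set"
    and BSG B :: "nat \<Rightarrow> 'a \<Rightarrow> nat \<Rightarrow> real"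
  assumes prob: "prob_space M"
    and Theta: "\<Theta> \<subseteq> {t. quad_var \<nu>0 \<nu>1 \<nu>2 t \<ge> 0}"
    and theta: "\<And>i. i \<ge> 1 \<Longrightarrow> \<theta> i \<in> \<Theta>"
    and tau_pos: "\<And>i. i \<ge> 1 \<Longrightarrow> \<tau> i > 0"
    and tau_nu2: "\<And>i. i \<ge> 1 \<Longrightarrow> \<tau> i + \<nu>2 \<noteq> 0"
    and indep: "prob_space.indep_vars M (\<lambda>_. borel) Y {1..}"
    and int1: "\<And>i. i \<ge> 1 \<Longrightarrow> integrable M (Y i)"
    and mean: "\<And>i. i \<ge> 1 \<Longrightarrow> prob_space.expectation M (Y i) = \<theta> i"
    and int2: "\<And>i. i \<ge> 1 \<Longrightarrow> integrable M (\<lambda>\<omega>. (Y i \<omega>)\<^sup>2)"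
    and var: "\<And>i. i \<ge> 1 \<Longrightarrow> prob_space.variance M (Y i) = quad_var \<nu>0 \<nu>1 \<nu>2 (\<theta> i) / \<tau> i"
    and condA: "limsup (\<lambda>p. ereal (1 / real p * (\<Sum>i=1..p. prob_space.variance M (Y i)))) < \<infinity>"
    and condB: "limsup (\<lambda>p. ereal (1 / real p * (\<Sum>i=1..p. prob_space.variance M (Y i) * (\<theta> i)\<^sup>2))) < \<infinity>"
    and condC_int: "\<And>i. i \<ge> 1 \<Longrightarrow> integrable M (\<lambda>\<omega>. (Y i \<omega>) ^ 4)"
    and condC: "limsup (\<lambda>p. ereal (1 / real p * (\<Sum>i=1..p. prob_space.variance M (\<lambda>\<omega>. (Y i \<omega>)\<^sup>2)))) < \<infinity>"
    and condD1: "(SUP i\<in>{1..}. ereal ((\<tau> i / (\<tau> i + \<nu>2))\<^sup>2)) < \<infinity>"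
    and condD2: "(SUP i\<in>{1..}. ereal ((\<nu>1 / (\<tau> i + \<nu>2))\<^sup>2)) < \<infinity>"
    and condE: "\<exists>\<epsilon>>0. limsup (\<lambda>p. ereal (1 / (real p powr (1 - \<epsilon>)) *
              prob_space.expectation M (\<lambda>\<omega>. Max ((\<lambda>i. (Y i \<omega>)\<^sup>2) ` {1..p})))) < \<infinity>"
    and SG: "\<And>p. p \<ge> 1 \<Longrightarrow> SG_weights M \<nu>0 \<nu>1 \<nu>2 \<tau> p Y (BSG p)"
    and weights: "\<And>p. p \<ge> 1 \<Longrightarrow> random_weights M p \<tau> (B p)"
  shows "(\<forall>\<epsilon>>0. (\<lambda>p. measure M {\<omega> \<in> space M.
            loss p \<theta> (shrink p (BSG p \<omega>) (\<lambda>i. Y i \<omega>))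
              \<ge> loss p \<theta> (shrink p (B p \<omega>) (\<lambda>i. Y i \<omega>)) + \<epsilon>}) \<longlonglongrightarrow> 0)
    \<and> limsup (\<lambda>p. ereal (
            risk M p \<theta> (\<lambda>\<omega>. shrink p (BSG p \<omega>) (\<lambda>i. Y i \<omega>))
            - risk M p \<theta> (\<lambda>\<omega>. shrink p (B p \<omega>) (\<lambda>i. Y i \<omega>)))) \<le> 0"
proof -
  interpret prob_space M by (rule prob)
  interpret quadratic_variance_model M Y \<theta> \<tau> \<nu>0 \<nu>1 \<nu>2
    by unfold_locales (fact tau_pos tau_nu2 indep int1 mean int2 var condC_int)+
  obtain e where e: "e > 0" and condE': "limsup (\<lambda>p. ereal (1 / (real p powr (1 - e)) *
              expectation (\<lambda>\<omega>. Max ((\<lambda>i. (Y i \<omega>)\<^sup>2) ` {1..p})))) < \<infinity>"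
    using condE by blast
  have "\<exists>\<sigma>. bij_betw \<sigma> {..<p} {1..p} \<and> (\<forall>j k. j \<le> k \<longrightarrow> k < p \<longrightarrow> \<tau> (\<sigma> j) \<le> \<tau> (\<sigma> k))" for p
    using increasing_enumeration[of p \<tau>] by metis
  then obtain \<sigma> where bij: "\<And>p. bij_betw (\<sigma> p) {..<p} {1..p}"
    and inc: "\<And>p j k. j \<le> k \<Longrightarrow> k < p \<Longrightarrow> \<tau> (\<sigma> p j) \<le> \<tau> (\<sigma> p k)"
    by metis
  let ?G = "\<lambda>p \<omega>. URE_gap_bound \<nu>0 \<nu>1 \<nu>2 \<tau> (\<sigma> p) p \<theta> (\<lambda>i. Y i \<omega>)"
  let ?l = "\<lambda>B p \<omega>. loss p \<theta> (shrink p (B p \<omega>) (\<lambda>i. Y i \<omega>))"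
  have EG: "(\<lambda>p. expectation (?G p)) \<longlonglongrightarrow> 0"
    by (rule URE_gap_bound_expectation_tendsto_0[OF bij condA condB condC condD1 condD2 e condE'])
  have intG: "integrable M (?G p)" if "p \<ge> 1" for p
    by (rule URE_gap_bound_expectation(1)[OF that bij, of 1 1]) auto
  have dom: "?l BSG p \<omega> \<le> ?l B p \<omega> + 4 * ?G p \<omega>" if "p \<ge> 1" "\<omega> \<in> space M" for p \<omega>
  proof (rule loss_le_of_URE_G_le[where \<sigma> = "\<sigma> p"])
    show "admissible_weights p \<tau> (BSG p \<omega>)"
      using SG_weights_imp(1)[OF SG[OF that(1)]] that(2) by (simp add: random_weights_def)
    show B: "admissible_weights p \<tau> (B p \<omega>)"
      using weights[OF that(1)] that(2) by (simp add: random_weights_def)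
    show "URE_G \<nu>0 \<nu>1 \<nu>2 \<tau> p (\<lambda>i. Y i \<omega>) (BSG p \<omega>) \<le> URE_G \<nu>0 \<nu>1 \<nu>2 \<tau> p (\<lambda>i. Y i \<omega>) (B p \<omega>)"
      by (rule SG_weights_imp(2)[OF SG[OF that(1)] that(2) B])
  qed (rule bij, rule inc)
  have "(\<lambda>p. prob {\<omega> \<in> space M. ?l BSG p \<omega> \<ge> ?l B p \<omega> + \<epsilon>}) \<longlonglongrightarrow> 0" if "\<epsilon> > 0" for \<epsilon> :: real
  proof (rule tendsto_sandwich[where f = "\<lambda>_. 0" and h = "\<lambda>p. 4 * expectation (?G p) / \<epsilon>"])
    show "(\<lambda>p. 4 * expectation (?G p) / \<epsilon>) \<longlonglongrightarrow> 0"
      using tendsto_mult_left[OF EG, of "4 / \<epsilon>"] by simp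
    show "eventually (\<lambda>p. prob {\<omega> \<in> space M. ?l BSG p \<omega> \<ge> ?l B p \<omega> + \<epsilon>}
        \<le> 4 * expectation (?G p) / \<epsilon>) sequentially"
      using eventually_ge_at_top[of 1]
    proof eventually_elim
      case (elim p)
      have G4: "integrable M (\<lambda>\<omega>. 4 * ?G p \<omega>)" using intG[OF elim] by simp
      have "prob {\<omega> \<in> space M. ?l BSG p \<omega> \<ge> ?l B p \<omega> + \<epsilon>} \<le> prob {\<omega> \<in> space M. 4 * ?G p \<omega> \<ge> \<epsilon>}"
      proof (rule finite_measure_mono)
        show "{\<omega> \<in> space M. 4 * ?G p \<omega> \<ge> \<epsilon>} \<in> sets M"
          using borel_measurable_integrable[OF G4] by measurable
        show "{\<omega> \<in> space M. ?l BSG p \<omega> \<ge> ?l B p \<omega> + \<epsilon>} \<subseteq> {\<omega> \<in> space M. 4 * ?G p \<omega> \<ge> \<epsilon>}"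
          using dom[OF elim] by fastforce
      qed
      also have "\<dots> \<le> expectation (\<lambda>\<omega>. 4 * ?G p \<omega>) / \<epsilon>"
        by (rule integral_Markov_inequality_measure[OF G4 sets.top _ that])
           (simp add: URE_gap_bound_nonneg)
      finally show ?case by simp
    qed
  qed auto
  moreover have "limsup (\<lambda>p. ereal (
            risk M p \<theta> (\<lambda>\<omega>. shrink p (BSG p \<omega>) (\<lambda>i. Y i \<omega>))
            - risk M p \<theta> (\<lambda>\<omega>. shrink p (B p \<omega>) (\<lambda>i. Y i \<omega>)))) \<le> 0"
  proof -
    have "limsup (\<lambda>p. ereal (
            risk M p \<theta> (\<lambda>\<omega>. shrink p (BSG p \<omega>) (\<lambda>i. Y i \<omega>))
            - risk M p \<theta> (\<lambda>\<omega>. shrink p (B p \<omega>) (\<lambda>i. Y i \<omega>))))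
      \<le> limsup (\<lambda>p. ereal (4 * expectation (?G p)))"
    proof (rule Limsup_mono)
      show "eventually (\<lambda>p. ereal (
            risk M p \<theta> (\<lambda>\<omega>. shrink p (BSG p \<omega>) (\<lambda>i. Y i \<omega>))
            - risk M p \<theta> (\<lambda>\<omega>. shrink p (B p \<omega>) (\<lambda>i. Y i \<omega>))) \<le> ereal (4 * expectation (?G p))) sequentially"
        using eventually_ge_at_top[of 1]
      proof eventually_elim
        case (elim p)
        have intl: "integrable M (?l BSG p)" "integrable M (?l B p)"
          by (rule integrable_loss_shrink[OF elim] SG_weights_imp(1)[OF SG] weights elim)+
        have "expectation (?l BSG p) \<le> expectation (\<lambda>\<omega>. ?l B p \<omega> + 4 * ?G p \<omega>)"
          using intl intG[OF elim] dom[OF elim] by (intro integral_mono) auto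
        also have "\<dots> = expectation (?l B p) + 4 * expectation (?G p)"
          using intl intG[OF elim] by simp
        finally show ?case by (simp add: risk_def)
      qed
    qed
    also have "(\<lambda>p. ereal (4 * expectation (?G p))) \<longlonglongrightarrow> ereal 0"
      using tendsto_mult_left[OF EG, of 4] by simp
    then have "limsup (\<lambda>p. ereal (4 * expectation (?G p))) = 0"
      by (intro lim_imp_Limsup) (auto simp: zero_ereal_def)
    finally show ?thesis .
  qed
  ultimately show ?thesis by blast
qed

end
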